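(* Let $s\in\{2,3,\dots\}$. Consider a sample of $n=(s+1)k-1$ independent observations on a random variable $X$ with cumulative distribution function $F$ and probability density function $f=F'$, and let $X_{(1,n)}\le\dots\le X_{(n,n)}$ be the corresponding increasing order statistics. If $f\left[F^{\leftarrow}\left(\frac{1}{s+1}\right)\right]$ and $f\left[F^{\leftarrow}\left(\frac{s}{s+1}\right)\right]$ exist and satisfy $$0<f\left[F^{\leftarrow}\left(\tfrac{1}{s+1}\right)\right]<\infty,\qquad 0<f\left[F^{\leftarrow}\left(\tfrac{s}{s+1}\right)\right]<\infty ,$$ then, for $k\to\infty$, $$T_{k,s}:=\sqrt{(s+1)k-1}\left[\log\left(\frac{X_{(ks,(s+1)k-1)}}{X_{(k,(s+1)k-1)}}\right)-\log\left(\frac{F^{\leftarrow}(\frac{s}{s+1})}{F^{\leftarrow}(\frac{1}{s+1})}\right)\right]\stackrel{d}{\to}N(0,V),$$ where the variance is $$V=\frac{1}{(s+1)^2}\left(\frac{s}{a_{F,s}^2}-\frac{2}{a_{F,s}b_{F,s}}+\frac{s}{b_{F,s}^2}\right),$$ with $$a_{F,s}=F^{\leftarrow}\left(\tfrac{1}{s+1}\right)f\left[F^{\leftarrow}\left(\tfrac{1}{s+1}\right)\right]=\frac{1}{\{\log[F^{\leftarrow}(p)]\}'|_{p=\frac{1}{s+1}}},\qquad b_{F,s}=F^{\leftarrow}\left(\tfrac{s}{s+1}\right)f\left[F^{\leftarrow}\left(\tfrac{s}{s+1}\right)\right]=\frac{1}{\{\log[F^{\leftarrow}(p)]\}'|_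{p=\frac{s}{s+1}}}.$$
   Context: $F^{\leftarrow}(p)=\inf\{x: F(x)\ge p\}$ denotes the quantile function of $F$. $X_{(i,n)}$ denotes the $i$-th smallest of $n$ independent observations on $X$. $\stackrel{d}{\to}$ means convergence in distribution, $N(\mu,\sigma^2)$ is the normal distribution with mean $\mu$ and variance $\sigma^2$, and $\log$ is the natural logarithm. *)

theory Defs
  imports "HOL-Probability.Probability"
begin

text \<open>Only used for \<open>0 < p < 1\<close> and a distribution function \<open>F\<close>, where the set is nonempty and
  bounded below, so that the real \<open>Inf\<close> is the genuine infimum.\<close>

definition quantile :: "(real \<Rightarrow> real) \<Rightarrow> real \<Rightarrow> real" where
  "quantile F p = Inf {x. p \<le> F x}"

text \<open>The \<open>i\<close>-th smallest (\<open>1 \<le> i \<le> n\<close>, counted with multiplicity) of \<open>x 0, \<dots>, x (n - 1)\<close>.\<close>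

definition order_stat :: "nat \<Rightarrow> nat \<Rightarrow> (nat \<Rightarrow> real) \<Rightarrow> real" where
  "order_stat i n x = sort (map x [0..<n]) ! (i - 1)"

definition iid_sample :: "'a measure \<Rightarrow> real measure \<Rightarrow> nat \<Rightarrow> (nat \<Rightarrow> 'a \<Rightarrow> real) \<Rightarrow> bool" where
  "iid_sample P \<mu> n Y \<longleftrightarrow> prob_space P \<and>
     prob_space.indep_vars P (\<lambda>_. borel) Y {..<n} \<and> (\<forall>i<n. distr P borel (Y i) = \<mu>)"

definition normal_distr :: "real \<Rightarrow> real \<Rightarrow> real measure" where
  "normal_distr m v = density lborel (\<lambda>x. ennreal (normal_density m (sqrt v) x))"

definition p_low :: "nat \<Rightarrow> real" where
  "p_low s = 1 / (real s + 1)"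

definition p_high :: "nat \<Rightarrow> real" where
  "p_high s = real s / (real s + 1)"

text \<open>The statistic \<open>T\<^bsub>k,s\<^esub>\<close> as a function of the observations \<open>x 0, \<dots>, x (n - 1)\<close>. The subtraction
  in \<open>n\<close> truncates only for \<open>k = 0\<close>, and the value of \<open>ln\<close> at nonpositive arguments is immaterial
  in the limit.\<close>

definition T_stat :: "(real \<Rightarrow> real) \<Rightarrow> nat \<Rightarrow> nat \<Rightarrow> (nat \<Rightarrow> real) \<Rightarrow> real" where
  "T_stat F s k x =
     (let n = (s + 1) * k - 1 in
      sqrt (real n) *
        (ln (order_stat (k * s) n x / order_stat k n x)
         - ln (quantile F (p_high s) / quantile F (p_low s))))"

definition a_coeff :: "(real \<Rightarrow> real) \<Rightarrow> (real \<Rightarrow> real) \<Rightarrow> nat \<Rightarrow> real" where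
  "a_coeff F f s = quantile F (p_low s) * f (quantile F (p_low s))"

definition b_coeff :: "(real \<Rightarrow> real) \<Rightarrow> (real \<Rightarrow> real) \<Rightarrow> nat \<Rightarrow> real" where
  "b_coeff F f s = quantile F (p_high s) * f (quantile F (p_high s))"

definition asym_var :: "(real \<Rightarrow> real) \<Rightarrow> (real \<Rightarrow> real) \<Rightarrow> nat \<Rightarrow> real" where
  "asym_var F f s =
     1 / (real s + 1)\<^sup>2 *
       (real s / (a_coeff F f s)\<^sup>2 - 2 / (a_coeff F f s * b_coeff F f s) + real s / (b_coeff F f s)\<^sup>2)"

end

theory Submission
  imports Defs
begin

text \<open>
  Let \<open>F\<^sub>n\<close> be the empirical distribution function. The event \<open>X\<^sub>(\<^sub>i\<^sub>) \<le> t\<close> is \<open>i/n \<le> F\<^sub>n t\<close>, and for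
  \<open>t = q + y / \<surd>n\<close> the fluctuations \<open>\<surd>n (F - F\<^sub>n)\<close> at \<open>t\<close> and at \<open>q\<close> differ by a quantity whose
  second moment is at most \<open>\<bar>F t - F q\<bar>\<close>. Comparing level sets at a fixed grid of values \<open>y\<close> gives
  Ghosh's form of the Bahadur representation: \<open>\<surd>n (X\<^sub>(\<^sub>i\<^sub>) - q)\<close> and \<open>\<surd>n (F q - F\<^sub>n q) / F' q\<close>
  differ by a quantity tending to \<open>0\<close> in probability, and \<open>F\<close> need only be differentiable at \<open>q\<close>. The delta
  method for \<open>ln\<close> turns the statistic into a normalized sum of bounded independent variables up to
  a vanishing error, so the one-dimensional central limit theorem suffices. The samples live on
  different probability spaces, but only their laws matter, so all of them may be taken as prefixes
  of one infinite independent sequence.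
\<close>

section \<open>Order statistics\<close>

text \<open>After sorting, the values at most \<open>t\<close> fill an initial segment, and position
  \<open>i - 1\<close> (counted from 0) lies in it exactly when the segment has at least
  \<open>i\<close> entries; sorting does not change the count. Order statistics thereby become sums
  of indicators.\<close>

lemma order_stat_le_iff:
  assumes "1 \<le> i" "i \<le> n"
  shows "order_stat i n x \<le> t \<longleftrightarrow> i \<le> card {j. j < n \<and> x j \<le> t}"
proof -
  define ys where "ys = sort (map x [0..<n])"
  have len: "length ys = n" and srt: "sorted ys" by (simp_all add: ys_def)
  have "card {j. j < n \<and> x j \<le> t} = length (filter (\<lambda>y. y \<le> t) (map x [0..<n]))"
    by (simp add: length_filter_conv_card) (metis nth_map_upt add.left_neutral diff_zero)
  also have "\<dots> = length (filter (\<lambda>y. y \<le> t) ys)"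
    unfolding ys_def by (metis filter_sort length_sort)
  finally have c: "card {j. j < n \<and> x j \<le> t} = card {j. j < n \<and> ys ! j \<le> t}"
    by (simp add: length_filter_conv_card len)
  have "ys ! (i - 1) \<le> t \<longleftrightarrow> i \<le> card {j. j < n \<and> ys ! j \<le> t}"
  proof
    assume "ys ! (i - 1) \<le> t"
    then have "{..<i} \<subseteq> {j. j < n \<and> ys ! j \<le> t}"
      using assms srt len by (auto intro: order_trans[OF sorted_nth_mono[of ys _ "i - 1"]])
    then show "i \<le> card {j. j < n \<and> ys ! j \<le> t}"
      using card_mono[of "{j. j < n \<and> ys ! j \<le> t}" "{..<i}"] by simp
  next
    assume *: "i \<le> card {j. j < n \<and> ys ! j \<le> t}"
    show "ys ! (i - 1) \<le> t"
    proof (rule ccontr)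
      assume "\<not> ys ! (i - 1) \<le> t"
      then have "{j. j < n \<and> ys ! j \<le> t} \<subseteq> {..<i - 1}"
        using assms srt len
        by (auto simp: not_le) (metis leI order_trans not_le sorted_nth_mono)
      from card_mono[OF _ this] * assms show False by simp
    qed
  qed
  with c show ?thesis by (simp add: order_stat_def ys_def)
qed

lemma order_stat_measurable:
  assumes Y: "\<And>j. j < n \<Longrightarrow> Y j \<in> borel_measurable M" and i: "1 \<le> i" "i \<le> n"
  shows "(\<lambda>\<omega>. order_stat i n (\<lambda>j. Y j \<omega>)) \<in> borel_measurable M"
proof (rule borel_measurable_iff_le[THEN iffD2], rule allI)
  fix t :: real
  define c where "c \<omega> = card {j. j < n \<and> Y j \<omega> \<le> t}" for \<omega>
  have c: "real (c \<omega>) = (\<Sum>j<n. if Y j \<omega> \<le> t then 1 else 0)" for \<omega>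
    by (simp add: sum.If_cases Int_def c_def)
  have "order_stat i n (\<lambda>j. Y j \<omega>) \<le> t \<longleftrightarrow> real i \<le> real (c \<omega>)" for \<omega>
    by (simp add: order_stat_le_iff[OF i] c_def)
  then have "{\<omega> \<in> space M. order_stat i n (\<lambda>j. Y j \<omega>) \<le> t} = {\<omega> \<in> space M. real i \<le> real (c \<omega>)}"
    by simp
  also have "\<dots> \<in> sets M"
  proof -
    have "(\<lambda>\<omega>. if Y j \<omega> \<le> t then 1 else 0 :: real) \<in> borel_measurable M" if "j < n" for j
      using Y[OF that] by measurable
    then have [measurable]: "(\<lambda>\<omega>. real (c \<omega>)) \<in> borel_measurable M"
      unfolding c by (intro borel_measurable_sum) auto
    show ?thesis by measurable
  qed
  finally show "{\<omega> \<in> space M. order_stat i n (\<lambda>j. Y j \<omega>) \<le> t} \<in> sets M" .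
qed

lemma order_stat_cong:
  "(\<And>j. j < n \<Longrightarrow> x j = y j) \<Longrightarrow> order_stat i n x = order_stat i n y"
  unfolding order_stat_def by (subst map_cong[of _ _ x y]) auto

text \<open>Needed to read the law of the statistic off a finite product measure, where only the
  first \<open>n\<close> coordinates are kept.\<close>

lemma T_stat_cong:
  assumes "\<And>i. i < (s + 1) * k - 1 \<Longrightarrow> x i = y i"
  shows "T_stat F s k x = T_stat F s k y"
proof -
  have "order_stat i ((s + 1) * k - 1) x = order_stat i ((s + 1) * k - 1) y" for i
    by (rule order_stat_cong) (rule assms)
  then show ?thesis by (simp only: T_stat_def Let_def)
qed

lemma T_stat_measurable:
  assumes Y: "\<And>j. j < (s + 1) * k - 1 \<Longrightarrow> Y j \<in> borel_measurable M" and s: "1 \<le> s"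
  shows "(\<lambda>\<omega>. T_stat F s k (\<lambda>i. Y i \<omega>)) \<in> borel_measurable M"
\<comment> \<open>For \<open>k = 0\<close> the sample size truncates to 0, and the factor
  \<open>sqrt 0\<close> makes the statistic constantly 0, so the invalid rank 0 does no
  harm.\<close>
proof (cases "k = 0")
  case False
  define n where "n = (s + 1) * k - 1"
  have "1 * 1 \<le> k * s" using s False by (intro mult_le_mono) auto
  moreover have "n = k * s + k - 1" by (simp add: n_def algebra_simps)
  ultimately have i: "1 \<le> k" "k \<le> n" "1 \<le> k * s" "k * s \<le> n"
    using False by linarith+
  have [measurable]: "(\<lambda>\<omega>. order_stat k n (\<lambda>j. Y j \<omega>)) \<in> borel_measurable M"
    "(\<lambda>\<omega>. order_stat (k * s) n (\<lambda>j. Y j \<omega>)) \<in> borel_measurable M"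
    using order_stat_measurable[of n Y M, OF Y[folded n_def]] i by simp_all
  show ?thesis unfolding T_stat_def Let_def n_def[symmetric] by measurable
qed (simp add: T_stat_def)

section \<open>Convergence in probability\<close>

context prob_space
begin

section \<open>Calculus of the stochastic orders \<open>o_P(1)\<close> and
  \<open>O_P(1)\<close>\<close>

definition vanishes_in_prob :: "(nat \<Rightarrow> 'a \<Rightarrow> real) \<Rightarrow> bool" where
  "vanishes_in_prob Z \<longleftrightarrow> (\<forall>\<epsilon>>0. (\<lambda>k. prob {\<omega> \<in> space M. \<epsilon> < \<bar>Z k \<omega>\<bar>}) \<longlonglongrightarrow> 0)"

text \<open>This is \<open>O_P(1)\<close>, that is, tightness. The bound is asked only for large
  \<open>k\<close>, so that every vanishing sequence qualifies.\<close>

definition bounded_in_prob :: "(nat \<Rightarrow> 'a \<Rightarrow> real) \<Rightarrow> bool" where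
  "bounded_in_prob Z \<longleftrightarrow>
     (\<forall>\<eta>>0. \<exists>K. \<forall>\<^sub>F k in sequentially. prob {\<omega> \<in> space M. K < \<bar>Z k \<omega>\<bar>} \<le> \<eta>)"

lemma vanishes_in_prob_bound:
  assumes "vanishes_in_prob Z" "0 < \<epsilon>" "0 < \<eta>"
  shows "\<forall>\<^sub>F k in sequentially. prob {\<omega> \<in> space M. \<epsilon> < \<bar>Z k \<omega>\<bar>} < \<eta>"
  using assms unfolding vanishes_in_prob_def by (metis order_tendstoD(2))

lemma vanishes_in_probI:
  assumes "\<And>\<epsilon> \<eta>. 0 < \<epsilon> \<Longrightarrow> 0 < \<eta> \<Longrightarrow>
    \<forall>\<^sub>F k in sequentially. prob {\<omega> \<in> space M. \<epsilon> < \<bar>Z k \<omega>\<bar>} \<le> \<eta>"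
  shows "vanishes_in_prob Z"
  unfolding vanishes_in_prob_def
proof (intro allI impI)
  fix \<epsilon> :: real assume "0 < \<epsilon>"
  show "(\<lambda>k. prob {\<omega> \<in> space M. \<epsilon> < \<bar>Z k \<omega>\<bar>}) \<longlonglongrightarrow> 0"
  proof (rule order_tendstoI)
    fix a :: real assume "a < 0"
    then show "\<forall>\<^sub>F k in sequentially. a < prob {\<omega> \<in> space M. \<epsilon> < \<bar>Z k \<omega>\<bar>}"
      by (intro always_eventually allI) (meson less_le_trans measure_nonneg)
  next
    fix a :: real assume "0 < a"
    then show "\<forall>\<^sub>F k in sequentially. prob {\<omega> \<in> space M. \<epsilon> < \<bar>Z k \<omega>\<bar>} < a"
      using assms[OF \<open>0 < \<epsilon>\<close>, of "a / 2"] by (auto elim!: eventually_mono)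
  qed
qed

text \<open>The union bound in the form used by the estimates below: a deviation can occur only
  through one of two controlled events.\<close>

lemma prob_le_two:
  assumes "{\<omega> \<in> space M. P \<omega>} \<subseteq> {\<omega> \<in> space M. Q \<omega>} \<union> {\<omega> \<in> space M. R \<omega>}"
    and [measurable]: "Measurable.pred M Q" "Measurable.pred M R"
    and "prob {\<omega> \<in> space M. Q \<omega>} \<le> a" "prob {\<omega> \<in> space M. R \<omega>} \<le> b"
  shows "prob {\<omega> \<in> space M. P \<omega>} \<le> a + b"
proof -
  have "prob {\<omega> \<in> space M. P \<omega>} \<le> prob ({\<omega> \<in> space M. Q \<omega>} \<union> {\<omega> \<in> space M. R \<omega>})"
    by (rule finite_measure_mono[OF assms(1)]) measurable
  also have "\<dots> \<le> prob {\<omega> \<in> space M. Q \<omega>} + prob {\<omega> \<in> space M. R \<omega>}"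
    by (rule measure_Un_le) measurable
  finally show ?thesis using assms(4,5) by linarith
qed

lemma vanishes_in_prob_add:
  assumes Z: "vanishes_in_prob Z" and Z': "vanishes_in_prob Z'"
    and [measurable]: "\<And>k. Z k \<in> borel_measurable M" "\<And>k. Z' k \<in> borel_measurable M"
  shows "vanishes_in_prob (\<lambda>k \<omega>. Z k \<omega> + Z' k \<omega>)"
proof (rule vanishes_in_probI)
  fix \<epsilon> \<eta> :: real assume "0 < \<epsilon>" "0 < \<eta>"
  have "\<forall>\<^sub>F k in sequentially. prob {\<omega> \<in> space M. \<epsilon> / 2 < \<bar>Z k \<omega>\<bar>} < \<eta> / 2"
    "\<forall>\<^sub>F k in sequentially. prob {\<omega> \<in> space M. \<epsilon> / 2 < \<bar>Z' k \<omega>\<bar>} < \<eta> / 2"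
    using \<open>0 < \<epsilon>\<close> \<open>0 < \<eta>\<close> vanishes_in_prob_bound[OF Z] vanishes_in_prob_bound[OF Z'] half_gt_zero
    by blast+
  then show "\<forall>\<^sub>F k in sequentially. prob {\<omega> \<in> space M. \<epsilon> < \<bar>Z k \<omega> + Z' k \<omega>\<bar>} \<le> \<eta>"
  proof eventually_elim
    case (elim k)
    have "prob {\<omega> \<in> space M. \<epsilon> < \<bar>Z k \<omega> + Z' k \<omega>\<bar>} \<le> \<eta> / 2 + \<eta> / 2"
      by (rule prob_le_two[where Q = "\<lambda>\<omega>. \<epsilon> / 2 < \<bar>Z k \<omega>\<bar>" and R = "\<lambda>\<omega>. \<epsilon> / 2 < \<bar>Z' k \<omega>\<bar>"])
        (use elim in auto)
    then show ?case by simp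
  qed
qed

lemma bounded_in_prob_of_vanishes: "vanishes_in_prob Z \<Longrightarrow> bounded_in_prob Z"
  unfolding bounded_in_prob_def
proof (intro allI impI)
  fix \<eta> :: real assume Z: "vanishes_in_prob Z" and "0 < \<eta>"
  from vanishes_in_prob_bound[OF Z zero_less_one \<open>0 < \<eta>\<close>]
  have "\<forall>\<^sub>F k in sequentially. prob {\<omega> \<in> space M. 1 < \<bar>Z k \<omega>\<bar>} \<le> \<eta>"
    by (auto elim: eventually_mono)
  then show "\<exists>K. \<forall>\<^sub>F k in sequentially. prob {\<omega> \<in> space M. K < \<bar>Z k \<omega>\<bar>} \<le> \<eta>" ..
qed

lemma bounded_in_prob_add:
  assumes Z: "bounded_in_prob Z" and Z': "bounded_in_prob Z'"
    and [measurable]: "\<And>k. Z k \<in> borel_measurable M" "\<And>k. Z' k \<in> borel_measurable M"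
  shows "bounded_in_prob (\<lambda>k \<omega>. Z k \<omega> + Z' k \<omega>)"
  unfolding bounded_in_prob_def
proof (intro allI impI)
  fix \<eta> :: real assume "0 < \<eta>"
  then obtain K K' where "\<forall>\<^sub>F k in sequentially. prob {\<omega> \<in> space M. K < \<bar>Z k \<omega>\<bar>} \<le> \<eta> / 2"
    "\<forall>\<^sub>F k in sequentially. prob {\<omega> \<in> space M. K' < \<bar>Z' k \<omega>\<bar>} \<le> \<eta> / 2"
    using Z Z' unfolding bounded_in_prob_def by (meson half_gt_zero)
  then have "\<forall>\<^sub>F k in sequentially. prob {\<omega> \<in> space M. K + K' < \<bar>Z k \<omega> + Z' k \<omega>\<bar>} \<le> \<eta>"
  proof eventually_elim
    case (elim k)
    have "prob {\<omega> \<in> space M. K + K' < \<bar>Z k \<omega> + Z' k \<omega>\<bar>} \<le> \<eta> / 2 + \<eta> / 2"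
      by (rule prob_le_two[where Q = "\<lambda>\<omega>. K < \<bar>Z k \<omega>\<bar>" and R = "\<lambda>\<omega>. K' < \<bar>Z' k \<omega>\<bar>"])
        (use elim in auto)
    then show ?case by simp
  qed
  then show "\<exists>K. \<forall>\<^sub>F k in sequentially. prob {\<omega> \<in> space M. K < \<bar>Z k \<omega> + Z' k \<omega>\<bar>} \<le> \<eta>" ..
qed

lemma vanishes_in_prob_mult_bounded:
  assumes Z: "bounded_in_prob Z" and R: "vanishes_in_prob R"
    and [measurable]: "\<And>k. Z k \<in> borel_measurable M" "\<And>k. R k \<in> borel_measurable M"
  shows "vanishes_in_prob (\<lambda>k \<omega>. Z k \<omega> * R k \<omega>)"
proof (rule vanishes_in_probI)
  fix \<epsilon> \<eta> :: real assume "0 < \<epsilon>" "0 < \<eta>"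
  then obtain K where K: "\<forall>\<^sub>F k in sequentially. prob {\<omega> \<in> space M. K < \<bar>Z k \<omega>\<bar>} \<le> \<eta> / 2"
    using Z unfolding bounded_in_prob_def by (meson half_gt_zero)
  \<comment> \<open>Off the two exceptional events the product is at most
    \<open>(\<bar>K\<bar> + 1) * \<delta> = \<epsilon>\<close>; adding 1 to
    \<open>\<bar>K\<bar>\<close> keeps the denominator positive for every \<open>K\<close>.\<close>
  define \<delta> where "\<delta> = \<epsilon> / (\<bar>K\<bar> + 1)"
  have "0 < \<delta>" using \<open>0 < \<epsilon>\<close> by (simp add: \<delta>_def)
  then have "\<forall>\<^sub>F k in sequentially. prob {\<omega> \<in> space M. \<delta> < \<bar>R k \<omega>\<bar>} < \<eta> / 2"
    using \<open>0 < \<eta>\<close> by (intro vanishes_in_prob_bound R) auto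
  with K show "\<forall>\<^sub>F k in sequentially. prob {\<omega> \<in> space M. \<epsilon> < \<bar>Z k \<omega> * R k \<omega>\<bar>} \<le> \<eta>"
  proof eventually_elim
    case (elim k)
    have "prob {\<omega> \<in> space M. \<epsilon> < \<bar>Z k \<omega> * R k \<omega>\<bar>} \<le> \<eta> / 2 + \<eta> / 2"
    proof (rule prob_le_two[where Q = "\<lambda>\<omega>. K < \<bar>Z k \<omega>\<bar>" and R = "\<lambda>\<omega>. \<delta> < \<bar>R k \<omega>\<bar>"])
      have "\<bar>z * r\<bar> \<le> \<epsilon>" if "\<bar>z\<bar> \<le> K" "\<bar>r\<bar> \<le> \<delta>" for z r :: real
      proof -
        have "\<bar>z * r\<bar> \<le> (\<bar>K\<bar> + 1) * \<delta>"
          unfolding abs_mult using that by (intro mult_mono) auto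
        also have "\<dots> = \<epsilon>" by (simp add: \<delta>_def)
        finally show ?thesis .
      qed
      then show "{\<omega> \<in> space M. \<epsilon> < \<bar>Z k \<omega> * R k \<omega>\<bar>}
          \<subseteq> {\<omega> \<in> space M. K < \<bar>Z k \<omega>\<bar>} \<union> {\<omega> \<in> space M. \<delta> < \<bar>R k \<omega>\<bar>}"
        by (auto simp: not_less[symmetric])
    qed (use elim in auto)
    then show ?case by simp
  qed
qed

lemma bounded_in_prob_const: "bounded_in_prob (\<lambda>k \<omega>. c)"
  unfolding bounded_in_prob_def by (auto intro!: exI[of _ "\<bar>c\<bar>"])

lemma vanishes_in_prob_cmult:
  assumes "vanishes_in_prob Z" "\<And>k. Z k \<in> borel_measurable M"
  shows "vanishes_in_prob (\<lambda>k \<omega>. c * Z k \<omega>)"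
  by (rule vanishes_in_prob_mult_bounded[OF bounded_in_prob_const assms(1)]) (use assms(2) in auto)

lemma vanishes_in_prob_const:
  assumes "c \<longlonglongrightarrow> 0"
  shows "vanishes_in_prob (\<lambda>k \<omega>. c k)"
proof (rule vanishes_in_probI)
  fix \<epsilon> \<eta> :: real assume "0 < \<epsilon>" "0 < \<eta>"
  have "\<forall>\<^sub>F k in sequentially. \<bar>c k\<bar> < \<epsilon>"
    using assms \<open>0 < \<epsilon>\<close> by (metis order_tendstoD(2) tendsto_rabs_zero)
  then show "\<forall>\<^sub>F k in sequentially. prob {\<omega> \<in> space M. \<epsilon> < \<bar>c k\<bar>} \<le> \<eta>"
    by eventually_elim (use \<open>0 < \<eta>\<close> in simp)
qed

text \<open>Continuous mapping at a constant limit: if \<open>U k\<close> is close to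
  \<open>q\<close>, then \<open>r (U k)\<close> is close to \<open>r q = 0\<close>.\<close>

lemma vanishes_in_prob_compose:
  fixes r :: "real \<Rightarrow> real"
  assumes D: "vanishes_in_prob (\<lambda>k \<omega>. U k \<omega> - q)" and r: "isCont r q" "r q = 0"
    and [measurable]: "\<And>k. U k \<in> borel_measurable M" "r \<in> borel_measurable borel"
  shows "vanishes_in_prob (\<lambda>k \<omega>. r (U k \<omega>))"
proof (rule vanishes_in_probI)
  fix \<epsilon> \<eta> :: real assume "0 < \<epsilon>" "0 < \<eta>"
  then obtain \<delta> where \<delta>: "0 < \<delta>" "\<And>x. \<bar>x - q\<bar> < \<delta> \<Longrightarrow> \<bar>r x\<bar> < \<epsilon>"
    using r unfolding continuous_at_eps_delta by (auto simp: dist_real_def)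
  \<comment> \<open>Half of \<delta> is taken because the complement of the event gives a weak
    inequality, while continuity asks for a strict one.\<close>
  have "\<forall>\<^sub>F k in sequentially. prob {\<omega> \<in> space M. \<delta> / 2 < \<bar>U k \<omega> - q\<bar>} < \<eta>"
    using \<delta> \<open>0 < \<eta>\<close> by (intro vanishes_in_prob_bound D) auto
  then show "\<forall>\<^sub>F k in sequentially. prob {\<omega> \<in> space M. \<epsilon> < \<bar>r (U k \<omega>)\<bar>} \<le> \<eta>"
  proof eventually_elim
    case (elim k)
    have "prob {\<omega> \<in> space M. \<epsilon> < \<bar>r (U k \<omega>)\<bar>} \<le> prob {\<omega> \<in> space M. \<delta> / 2 < \<bar>U k \<omega> - q\<bar>}"
      using \<delta> by (intro finite_measure_mono) (auto simp: not_less[symmetric], smt (verit, best) field_sum_of_halves)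
    with elim show ?case by simp
  qed
qed

section \<open>Chebyshev criteria, comparison through level sets, delta method, Slutsky\<close>

lemma vanishes_in_prob_second_moment:
  assumes Z: "\<And>k. Z k \<in> borel_measurable M" "\<And>k. integrable M (\<lambda>\<omega>. (Z k \<omega>)\<^sup>2)"
    and lim: "(\<lambda>k. expectation (\<lambda>\<omega>. (Z k \<omega>)\<^sup>2)) \<longlonglongrightarrow> 0"
  shows "vanishes_in_prob Z"
  unfolding vanishes_in_prob_def
proof (intro allI impI)
  fix \<epsilon> :: real assume "0 < \<epsilon>"
  have "prob {\<omega> \<in> space M. \<epsilon> < \<bar>Z k \<omega>\<bar>} \<le> expectation (\<lambda>\<omega>. (Z k \<omega>)\<^sup>2) / \<epsilon>\<^sup>2" for k
  proof -
    have "prob {\<omega> \<in> space M. \<epsilon> < \<bar>Z k \<omega>\<bar>} \<le> prob {\<omega> \<in> space M. \<epsilon> \<le> \<bar>Z k \<omega>\<bar>}"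
      using Z(1)[of k] by (intro finite_measure_mono) auto
    also have "\<dots> \<le> expectation (\<lambda>\<omega>. (Z k \<omega>)\<^sup>2) / \<epsilon>\<^sup>2"
      by (rule second_moment_method) (use Z \<open>0 < \<epsilon>\<close> in auto)
    finally show ?thesis .
  qed
  then show "(\<lambda>k. prob {\<omega> \<in> space M. \<epsilon> < \<bar>Z k \<omega>\<bar>}) \<longlonglongrightarrow> 0"
    by (intro tendsto_sandwich[OF _ _ tendsto_const tendsto_divide_zero[OF lim, of "\<epsilon>\<^sup>2"]]) auto
qed

lemma bounded_in_prob_second_moment:
  assumes Z: "\<And>k. Z k \<in> borel_measurable M" "\<And>k. integrable M (\<lambda>\<omega>. (Z k \<omega>)\<^sup>2)"
    and C: "\<And>k. expectation (\<lambda>\<omega>. (Z k \<omega>)\<^sup>2) \<le> C"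
  shows "bounded_in_prob Z"
  unfolding bounded_in_prob_def
proof (intro allI impI)
  fix \<eta> :: real assume "0 < \<eta>"
  \<comment> \<open>Chosen so that the Chebyshev bound
    \<open>(\<bar>C\<bar> + 1) / K\<^sup>2\<close> is exactly \<eta>; adding 1 makes
    \<open>K\<close> positive.\<close>
  define K where "K = sqrt ((\<bar>C\<bar> + 1) / \<eta>)"
  have K: "0 < K" "K\<^sup>2 = (\<bar>C\<bar> + 1) / \<eta>" using \<open>0 < \<eta>\<close> by (auto simp: K_def)
  have "prob {\<omega> \<in> space M. K < \<bar>Z k \<omega>\<bar>} \<le> \<eta>" for k
  proof -
    have "prob {\<omega> \<in> space M. K < \<bar>Z k \<omega>\<bar>} \<le> prob {\<omega> \<in> space M. K \<le> \<bar>Z k \<omega>\<bar>}"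
      using Z(1)[of k] by (intro finite_measure_mono) auto
    also have "\<dots> \<le> expectation (\<lambda>\<omega>. (Z k \<omega>)\<^sup>2) / K\<^sup>2"
      by (rule second_moment_method) (use Z K in auto)
    also have "\<dots> \<le> (\<bar>C\<bar> + 1) / K\<^sup>2"
      using C[of k] by (intro divide_right_mono) auto
    also have "\<dots> = \<eta>" using K(2) \<open>0 < \<eta>\<close> by auto
    finally show ?thesis .
  qed
  then show "\<exists>K. \<forall>\<^sub>F k in sequentially. prob {\<omega> \<in> space M. K < \<bar>Z k \<omega>\<bar>} \<le> \<eta>"
    by (auto intro!: exI[of _ K])
qed

text \<open>If \<open>V\<close> and \<open>W\<close> are more than \<epsilon> apart while
  \<open>W\<close> is bounded, some value \<open>y\<close> of a finite grid separates them with a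
  margin. Since \<open>V \<le> y\<close> means \<open>Z y \<le> c y\<close> with \<open>c y\<close>
  near \<open>y\<close>, the variable \<open>Z y\<close> is then on the side of \<open>V\<close>,
  hence far from \<open>W\<close>. Only finitely many \<open>y\<close> are involved, so this has
  small probability.\<close>

lemma vanishes_in_prob_level_sets:
  assumes [measurable]: "\<And>k. V k \<in> borel_measurable M" "\<And>k. W k \<in> borel_measurable M"
      "\<And>y k. Z y k \<in> borel_measurable M"
    and W: "bounded_in_prob W"
    and Z: "\<And>y. vanishes_in_prob (\<lambda>k \<omega>. Z y k \<omega> - W k \<omega>)"
    and c: "\<And>y. c y \<longlonglongrightarrow> y"
    and level: "\<And>y. \<forall>\<^sub>F k in sequentially. \<forall>\<omega>\<in>space M. V k \<omega> \<le> y \<longleftrightarrow> Z y k \<omega> \<le> c y k"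
  shows "vanishes_in_prob (\<lambda>k \<omega>. V k \<omega> - W k \<omega>)"
proof (rule vanishes_in_probI)
  fix \<epsilon> \<eta> :: real assume "0 < \<epsilon>" "0 < \<eta>"
  obtain K where K: "\<forall>\<^sub>F k in sequentially. prob {\<omega> \<in> space M. K < \<bar>W k \<omega>\<bar>} \<le> \<eta> / 2"
    using W \<open>0 < \<eta>\<close> unfolding bounded_in_prob_def by (meson half_gt_zero)
  \<comment> \<open>A grid of mesh \<open>\<epsilon> / 2\<close>, with enough indices that each
    point \<open>x\<close> of
    \<open>[-\<bar>K\<bar> - \<epsilon>, \<bar>K\<bar> + \<epsilon>]\<close> has a grid point in
    \<open>[x, x + \<epsilon> / 2]\<close>.\<close>
  define y where "y j = of_int j * (\<epsilon> / 2)" for j :: int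
  define J where "J = {\<lfloor>2 * (- \<bar>K\<bar> - \<epsilon>) / \<epsilon>\<rfloor> .. \<lceil>2 * (\<bar>K\<bar> + \<epsilon>) / \<epsilon>\<rceil>}"
  have grid: "\<exists>j\<in>J. x \<le> y j \<and> y j \<le> x + \<epsilon> / 2" if "- \<bar>K\<bar> - \<epsilon> \<le> x" "x \<le> \<bar>K\<bar> + \<epsilon>" for x
  proof (rule bexI[of _ "\<lceil>2 * x / \<epsilon>\<rceil>"])
    have "2 * x \<le> \<lceil>2 * x / \<epsilon>\<rceil> * \<epsilon>"
      using \<open>0 < \<epsilon>\<close> le_of_int_ceiling[of "2 * x / \<epsilon>"] by (simp only: pos_divide_le_eq)
    moreover have "\<lceil>2 * x / \<epsilon>\<rceil> * \<epsilon> \<le> (2 * x / \<epsilon> + 1) * \<epsilon>"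
      using \<open>0 < \<epsilon>\<close> by (intro mult_right_mono of_int_ceiling_le_add_one) auto
    moreover have "(2 * x / \<epsilon> + 1) * \<epsilon> = 2 * x + \<epsilon>" using \<open>0 < \<epsilon>\<close> by (simp add: field_simps)
    ultimately show "x \<le> y \<lceil>2 * x / \<epsilon>\<rceil> \<and> y \<lceil>2 * x / \<epsilon>\<rceil> \<le> x + \<epsilon> / 2"
      unfolding y_def by linarith
    have "2 * (- \<bar>K\<bar> - \<epsilon>) / \<epsilon> \<le> 2 * x / \<epsilon>" "2 * x / \<epsilon> \<le> 2 * (\<bar>K\<bar> + \<epsilon>) / \<epsilon>"
      using that \<open>0 < \<epsilon>\<close> by (intro divide_right_mono; simp)+
    then show "\<lceil>2 * x / \<epsilon>\<rceil> \<in> J"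
      by (auto simp: J_def intro: ceiling_mono order_trans[OF floor_le_ceiling ceiling_mono])
  qed
  have "finite J" by (simp add: J_def)
  \<comment> \<open>Below, the grid point is at least \<open>\<epsilon> / 2\<close> away from
    \<open>W\<close> and \<open>c\<close> is within \<open>\<epsilon> / 4\<close> of it, so
    \<open>Z\<close> and \<open>W\<close> are at least \<open>\<epsilon> / 4\<close> apart;
    \<open>\<epsilon> / 8\<close> leaves room for strictness.\<close>
  define B where "B k j = {\<omega> \<in> space M. \<epsilon> / 8 < \<bar>Z (y j) k \<omega> - W k \<omega>\<bar>}" for k j
  have B [measurable]: "B k j \<in> sets M" for k j unfolding B_def by measurable
  have "(\<lambda>k. \<Sum>j\<in>J. prob (B k j)) \<longlonglongrightarrow> 0"
    using Z \<open>0 < \<epsilon>\<close> unfolding B_def vanishes_in_prob_def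
    by (intro tendsto_null_sum) (blast intro: divide_pos_pos zero_less_numeral)
  then have "\<forall>\<^sub>F k in sequentially. (\<Sum>j\<in>J. prob (B k j)) < \<eta> / 2"
    using \<open>0 < \<eta>\<close> by (intro order_tendstoD(2)) auto
  moreover have "\<forall>\<^sub>F k in sequentially. \<forall>j\<in>J. (\<forall>\<omega>\<in>space M. V k \<omega> \<le> y j \<longleftrightarrow> Z (y j) k \<omega> \<le> c (y j) k)
      \<and> \<bar>c (y j) k - y j\<bar> < \<epsilon> / 4"
  proof (intro eventually_ball_finite[OF \<open>finite J\<close>] ballI)
    fix j
    have "(\<lambda>k. \<bar>c (y j) k - y j\<bar>) \<longlonglongrightarrow> 0"
      using c[of "y j"] by (simp add: LIM_zero tendsto_rabs_zero)
    then have "\<forall>\<^sub>F k in sequentially. \<bar>c (y j) k - y j\<bar> < \<epsilon> / 4"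
      using \<open>0 < \<epsilon>\<close> by (intro order_tendstoD(2)) auto
    with level[of "y j"] show "\<forall>\<^sub>F k in sequentially.
        (\<forall>\<omega>\<in>space M. V k \<omega> \<le> y j \<longleftrightarrow> Z (y j) k \<omega> \<le> c (y j) k) \<and> \<bar>c (y j) k - y j\<bar> < \<epsilon> / 4"
      by (rule eventually_conj)
  qed
  ultimately show "\<forall>\<^sub>F k in sequentially. prob {\<omega> \<in> space M. \<epsilon> < \<bar>V k \<omega> - W k \<omega>\<bar>} \<le> \<eta>"
    using K
  proof eventually_elim
    case (elim k)
    have "prob {\<omega> \<in> space M. \<epsilon> < \<bar>V k \<omega> - W k \<omega>\<bar>} \<le> \<eta> / 2 + \<eta> / 2"
    proof (rule prob_le_two[where Q = "\<lambda>\<omega>. K < \<bar>W k \<omega>\<bar>" and R = "\<lambda>\<omega>. \<omega> \<in> (\<Union>j\<in>J. B k j)"])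
      have "\<exists>j\<in>J. \<omega> \<in> B k j"
        if "\<omega> \<in> space M" "\<epsilon> < \<bar>V k \<omega> - W k \<omega>\<bar>" "\<bar>W k \<omega>\<bar> \<le> K" for \<omega>
      proof -
        have bnd: "- \<bar>K\<bar> - \<epsilon> \<le> W k \<omega> + \<epsilon> / 2" "W k \<omega> + \<epsilon> / 2 \<le> \<bar>K\<bar> + \<epsilon>"
          "- \<bar>K\<bar> - \<epsilon> \<le> W k \<omega> - \<epsilon>" "W k \<omega> - \<epsilon> \<le> \<bar>K\<bar> + \<epsilon>"
          using that(3) \<open>0 < \<epsilon>\<close> by linarith+
        show ?thesis
        proof (cases "W k \<omega> < V k \<omega>")
          \<comment> \<open>Here \<open>V\<close> exceeds \<open>W + \<epsilon>\<close>, so a grid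
            point in \<open>[W + \<epsilon> / 2, W + \<epsilon>]\<close> lies below \<open>V\<close>
            and still well above \<open>W\<close>.\<close>
          case True
          obtain j where j: "j \<in> J" "W k \<omega> + \<epsilon> / 2 \<le> y j" "y j \<le> W k \<omega> + \<epsilon> / 2 + \<epsilon> / 2"
            using grid[of "W k \<omega> + \<epsilon> / 2"] bnd by blast
          then have "\<not> V k \<omega> \<le> y j" using True that by auto
          then have "c (y j) k < Z (y j) k \<omega>" using elim j that by (auto simp: not_le)
          moreover have "\<bar>c (y j) k - y j\<bar> < \<epsilon> / 4" using elim j by auto
          ultimately have "\<epsilon> / 8 < \<bar>Z (y j) k \<omega> - W k \<omega>\<bar>" using j \<open>0 < \<epsilon>\<close> by linarith
          then show ?thesis using j that by (auto simp: B_def)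
        next
          \<comment> \<open>The mirror image: \<open>V\<close> is below
            \<open>W - \<epsilon>\<close>, and the grid point is taken in
            \<open>[W - \<epsilon>, W - \<epsilon> / 2]\<close>.\<close>
          case False
          obtain j where j: "j \<in> J" "W k \<omega> - \<epsilon> \<le> y j" "y j \<le> W k \<omega> - \<epsilon> + \<epsilon> / 2"
            using grid[of "W k \<omega> - \<epsilon>"] bnd by blast
          then have "V k \<omega> \<le> y j" using False that by auto
          then have "Z (y j) k \<omega> \<le> c (y j) k" using elim j that by auto
          moreover have "\<bar>c (y j) k - y j\<bar> < \<epsilon> / 4" using elim j by auto
          ultimately have "\<epsilon> / 8 < \<bar>Z (y j) k \<omega> - W k \<omega>\<bar>" using j \<open>0 < \<epsilon>\<close> by linarith
          then show ?thesis using j that by (auto simp: B_def)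
        qed
      qed
      then show "{\<omega> \<in> space M. \<epsilon> < \<bar>V k \<omega> - W k \<omega>\<bar>}
          \<subseteq> {\<omega> \<in> space M. K < \<bar>W k \<omega>\<bar>} \<union> {\<omega> \<in> space M. \<omega> \<in> (\<Union>j\<in>J. B k j)}"
        by (auto simp: not_less[symmetric])
      show "prob {\<omega> \<in> space M. K < \<bar>W k \<omega>\<bar>} \<le> \<eta> / 2" using elim by simp
      have "{\<omega> \<in> space M. \<omega> \<in> (\<Union>j\<in>J. B k j)} = (\<Union>j\<in>J. B k j)" by (auto simp: B_def)
      then have "prob {\<omega> \<in> space M. \<omega> \<in> (\<Union>j\<in>J. B k j)} \<le> (\<Sum>j\<in>J. prob (B k j))"
        using finite_measure_subadditive_finite[OF \<open>finite J\<close>, of "B k"] B by (simp add: image_subset_iff)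
      then show "prob {\<omega> \<in> space M. \<omega> \<in> (\<Union>j\<in>J. B k j)} \<le> \<eta> / 2" using elim by simp
      show "Measurable.pred M (\<lambda>\<omega>. \<omega> \<in> (\<Union>j\<in>J. B k j))"
        using \<open>finite J\<close> by (intro pred_sets2[of _ M] sets.finite_UN) auto
    qed measurable
    then show ?case by simp
  qed
qed

text \<open>Dividing a tight sequence by \<open>r k\<close>, which tends to infinity, gives
  consistency. The linearization error is then the tight factor times the error of the difference
  quotient of \<open>g\<close> at \<open>U k\<close>, which vanishes by continuous mapping.\<close>

lemma delta_method:
  fixes g :: "real \<Rightarrow> real"
  assumes g: "(g has_real_derivative g') (at q)" and [measurable]: "g \<in> borel_measurable borel"
    and U[measurable]: "\<And>k. U k \<in> borel_measurable M"
    and r: "filterlim r at_top sequentially"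
    and bdd: "bounded_in_prob (\<lambda>k \<omega>. r k * (U k \<omega> - q))"
  shows "vanishes_in_prob (\<lambda>k \<omega>. U k \<omega> - q)"
    and "vanishes_in_prob (\<lambda>k \<omega>. r k * (g (U k \<omega>) - g q) - g' * (r k * (U k \<omega> - q)))"
proof -
  have "vanishes_in_prob (\<lambda>k \<omega>. r k * (U k \<omega> - q) * (1 / r k))"
    by (intro vanishes_in_prob_mult_bounded bdd vanishes_in_prob_const tendsto_divide_0[OF tendsto_const]
        filterlim_at_top_imp_at_infinity r) measurable
  then have *: "(\<lambda>k. prob {\<omega> \<in> space M. \<epsilon> < \<bar>r k * (U k \<omega> - q) * (1 / r k)\<bar>}) \<longlonglongrightarrow> 0"
    if "0 < \<epsilon>" for \<epsilon>
    using that unfolding vanishes_in_prob_def by blast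
  \<comment> \<open>Cancelling \<open>r k\<close> against \<open>1 / r k\<close> requires a nonzero
    factor, guaranteed only for large \<open>k\<close>.\<close>
  have r0: "\<forall>\<^sub>F k in sequentially. 0 < r k"
    using r by (simp add: filterlim_at_top_dense)
  show U_q: "vanishes_in_prob (\<lambda>k \<omega>. U k \<omega> - q)"
    unfolding vanishes_in_prob_def
  proof (intro allI impI)
    fix \<epsilon> :: real assume "0 < \<epsilon>"
    show "(\<lambda>k. prob {\<omega> \<in> space M. \<epsilon> < \<bar>U k \<omega> - q\<bar>}) \<longlonglongrightarrow> 0"
      by (rule Lim_transform_eventually[OF *[OF \<open>0 < \<epsilon>\<close>]], rule eventually_mono[OF r0]) simp
  qed
  \<comment> \<open>The error of the difference quotient, set to 0 at \<open>q\<close>: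
    differentiability of \<open>g\<close> is its continuity there, and the product formula below
    stays valid when \<open>U k\<close> hits \<open>q\<close>.\<close>
  define h where "h x = (if x = q then 0 else (g x - g q) / (x - q) - g')" for x
  have [measurable]: "h \<in> borel_measurable borel" unfolding h_def by measurable
  have h: "isCont h q" unfolding isCont_def
  proof (rule Lim_transform_eventually)
    show "(\<lambda>x. (g x - g q) / (x - q) - g') \<midarrow>q\<rightarrow> h q"
      using g unfolding has_field_derivative_iff h_def by (simp add: LIM_zero)
    show "\<forall>\<^sub>F x in at q. (g x - g q) / (x - q) - g' = h x"
      by (auto simp: eventually_at_filter h_def)
  qed
  have "vanishes_in_prob (\<lambda>k \<omega>. r k * (U k \<omega> - q) * h (U k \<omega>))"
    by (intro vanishes_in_prob_mult_bounded bdd vanishes_in_prob_compose[OF U_q h]) (simp_all add: h_def)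
  also have "(\<lambda>k \<omega>. r k * (U k \<omega> - q) * h (U k \<omega>)) =
      (\<lambda>k \<omega>. r k * (g (U k \<omega>) - g q) - g' * (r k * (U k \<omega> - q)))"
    by (auto simp: fun_eq_iff h_def field_simps)
  finally show "vanishes_in_prob (\<lambda>k \<omega>. r k * (g (U k \<omega>) - g q) - g' * (r k * (U k \<omega> - q)))" .
qed

text \<open>Slutsky's argument: outside the event that they differ by more than \<epsilon>,
  \<open>S k \<le> x - \<epsilon>\<close> implies \<open>T k \<le> x\<close>, which implies
  \<open>S k \<le> x + \<epsilon>\<close>. Continuity of \<open>G\<close> at \<open>x\<close> closes
  the gap.\<close>

lemma cdf_tendsto_of_vanishing_difference:
  fixes G :: "real \<Rightarrow> real"
  assumes [measurable]: "\<And>k. S k \<in> borel_measurable M" "\<And>k. T k \<in> borel_measurable M"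
    and diff: "vanishes_in_prob (\<lambda>k \<omega>. T k \<omega> - S k \<omega>)"
    and S: "\<And>x. (\<lambda>k. cdf (distr M borel (S k)) x) \<longlonglongrightarrow> G x"
    and G: "isCont G x"
  shows "(\<lambda>k. cdf (distr M borel (T k)) x) \<longlonglongrightarrow> G x"
proof -
  have cdf: "cdf (distr M borel Z) x = prob {\<omega> \<in> space M. Z \<omega> \<le> x}"
    if [measurable]: "Z \<in> borel_measurable M" for Z :: "'a \<Rightarrow> real" and x
    by (simp add: cdf_def measure_distr vimage_def Int_def conj_commute)
  show ?thesis
  proof (rule LIMSEQ_I)
    fix \<eta> :: real assume "0 < \<eta>"
    then obtain \<delta> where \<delta>: "0 < \<delta>" "\<And>y. \<bar>y - x\<bar> < \<delta> \<Longrightarrow> \<bar>G y - G x\<bar> < \<eta> / 3"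
      using G unfolding continuous_at_eps_delta dist_real_def by (metis divide_pos_pos zero_less_numeral)
    define \<epsilon> where "\<epsilon> = \<delta> / 2"
    have \<epsilon>: "0 < \<epsilon>" "\<bar>G (x + \<epsilon>) - G x\<bar> < \<eta> / 3" "\<bar>G (x - \<epsilon>) - G x\<bar> < \<eta> / 3"
      using \<delta> by (auto simp: \<epsilon>_def)
    have S': "\<forall>\<^sub>F k in sequentially. \<bar>cdf (distr M borel (S k)) y - G y\<bar> < \<eta> / 3" for y
      using tendstoD[OF S[of y], of "\<eta> / 3"] \<open>0 < \<eta>\<close> by (simp add: dist_real_def)
    have "\<forall>\<^sub>F k in sequentially. prob {\<omega> \<in> space M. \<epsilon> < \<bar>T k \<omega> - S k \<omega>\<bar>} < \<eta> / 3"
      using \<open>0 < \<eta>\<close> \<epsilon> by (intro vanishes_in_prob_bound diff) auto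
    then have "\<forall>\<^sub>F k in sequentially. \<bar>cdf (distr M borel (T k)) x - G x\<bar> < \<eta>"
      using S'[of "x + \<epsilon>"] S'[of "x - \<epsilon>"]
    proof eventually_elim
      case (elim k)
      have "cdf (distr M borel (T k)) x
          \<le> cdf (distr M borel (S k)) (x + \<epsilon>) + prob {\<omega> \<in> space M. \<epsilon> < \<bar>T k \<omega> - S k \<omega>\<bar>}"
        unfolding cdf[OF assms(1)] cdf[OF assms(2)]
        by (rule prob_le_two[OF _ _ _ order_refl order_refl]) auto
      moreover have "cdf (distr M borel (S k)) (x - \<epsilon>)
          \<le> cdf (distr M borel (T k)) x + prob {\<omega> \<in> space M. \<epsilon> < \<bar>T k \<omega> - S k \<omega>\<bar>}"
        unfolding cdf[OF assms(1)] cdf[OF assms(2)]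
        by (rule prob_le_two[OF _ _ _ order_refl order_refl]) auto
      ultimately show ?case using elim \<epsilon> by linarith
    qed
    then show "\<exists>no. \<forall>k\<ge>no. norm (cdf (distr M borel (T k)) x - G x) < \<eta>"
      by (simp add: eventually_sequentially)
  qed
qed

end

section \<open>Linearization of order statistics\<close>

locale iid_sequence = prob_space +
  fixes Y :: "nat \<Rightarrow> 'a \<Rightarrow> real" and \<mu> :: "real measure"
  assumes indep: "indep_vars (\<lambda>_. borel) Y UNIV"
    and distr_Y: "\<And>i. distr M borel (Y i) = \<mu>"
begin

lemma Y_measurable [measurable]: "Y i \<in> borel_measurable M"
  using indep unfolding indep_vars_def2 by simp

sublocale \<mu>: real_distribution \<mu>
  by (subst distr_Y[of 0, symmetric], rule real_distribution_distr) simp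

lemma expectation_Y:
  fixes h :: "real \<Rightarrow> real"
  assumes "h \<in> borel_measurable borel"
  shows "expectation (\<lambda>\<omega>. h (Y i \<omega>)) = (LINT x|\<mu>. h x)"
  using assms by (simp add: integral_distr flip: distr_Y[of i])

lemma integrable_indicator_atMost [simp]: "integrable \<mu> (indicator {..t} :: real \<Rightarrow> real)"
  by (rule \<mu>.integrable_const_bound[of _ 1]) auto

text \<open>Boundedness gives integrability of all products; independence and mean zero annihilate
  the cross terms, so only the diagonal of the double sum remains.\<close>

lemma second_moment_sum:
  fixes h :: "real \<Rightarrow> real"
  assumes h [measurable]: "h \<in> borel_measurable borel" and B: "\<And>x. \<bar>h x\<bar> \<le> B"
    and zero: "(LINT x|\<mu>. h x) = 0"
  shows "integrable M (\<lambda>\<omega>. (\<Sum>j<n. h (Y j \<omega>))\<^sup>2)"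
    and "expectation (\<lambda>\<omega>. (\<Sum>j<n. h (Y j \<omega>))\<^sup>2) = real n * (LINT x|\<mu>. (h x)\<^sup>2)"
proof -
  have "0 \<le> B" using B[of 0] by linarith
  have hY: "integrable M (\<lambda>\<omega>. h (Y j \<omega>))" for j
    by (rule integrable_const_bound[of _ B]) (auto simp: B)
  have hh: "integrable M (\<lambda>\<omega>. h (Y i \<omega>) * h (Y j \<omega>))" for i j
    by (rule integrable_const_bound[of _ "B * B"]) (auto simp: abs_mult B \<open>0 \<le> B\<close> intro!: mult_mono)
  have cov: "expectation (\<lambda>\<omega>. h (Y i \<omega>) * h (Y j \<omega>)) = (if i = j then LINT x|\<mu>. (h x)\<^sup>2 else 0)" for i j
  proof (cases "i = j")
    case True
    then show ?thesis using expectation_Y[of "\<lambda>x. (h x)\<^sup>2" j] by (simp add: power2_eq_square)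
  next
    case False
    have "indep_vars (\<lambda>_. borel) (\<lambda>l \<omega>. h (Y l \<omega>)) {i, j}"
      by (rule indep_vars_compose2[OF indep_vars_subset[OF indep]]) auto
    from indep_vars_lebesgue_integral[OF _ this] False show ?thesis
      by (simp add: hY expectation_Y zero)
  qed
  show "integrable M (\<lambda>\<omega>. (\<Sum>j<n. h (Y j \<omega>))\<^sup>2)"
    by (simp add: power2_eq_square sum_product hh)
  show "expectation (\<lambda>\<omega>. (\<Sum>j<n. h (Y j \<omega>))\<^sup>2) = real n * (LINT x|\<mu>. (h x)\<^sup>2)"
    by (simp add: power2_eq_square[of "sum _ _"] sum_product hh cov)
qed

text \<open>The sign is opposite to that of the usual empirical process: a larger sum means fewer
  observations up to \<open>t\<close>, hence larger order statistics, so both fluctuate in the same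
  direction.\<close>

definition centered_indicator :: "real \<Rightarrow> real \<Rightarrow> real" where
  "centered_indicator t x = cdf \<mu> t - indicator {..t} x"

lemma centered_indicator_measurable [measurable]: "centered_indicator t \<in> borel_measurable borel"
  unfolding centered_indicator_def by measurable

lemma abs_centered_indicator_le: "\<bar>centered_indicator t x\<bar> \<le> 1"
  using \<mu>.cdf_nonneg[of t] \<mu>.cdf_bounded_prob[of t] by (auto simp: centered_indicator_def indicator_def)

lemma integrable_centered_indicator [simp]: "integrable \<mu> (centered_indicator t)"
  by (rule \<mu>.integrable_const_bound[of _ 1]) (auto simp: abs_centered_indicator_le)

lemma integral_centered_indicator [simp]: "(LINT x|\<mu>. centered_indicator t x) = 0"
  using \<mu>.prob_space by (simp add: centered_indicator_def cdf_def)

text \<open>The Brownian bridge covariance in the time scale of the distribution function. For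
  \<open>t \<le> u\<close> the product of the two indicators is the indicator of
  \<open>{..t}\<close>.\<close>

lemma integral_centered_indicator_mult:
  assumes "t \<le> u"
  shows "(LINT x|\<mu>. centered_indicator t x * centered_indicator u x) = cdf \<mu> t * (1 - cdf \<mu> u)"
proof -
  have "(LINT x|\<mu>. centered_indicator t x * centered_indicator u x) =
      (LINT x|\<mu>. cdf \<mu> t * cdf \<mu> u - cdf \<mu> t * indicator {..u} x - cdf \<mu> u * indicator {..t} x + indicator {..t} x)"
    using assms by (intro Bochner_Integration.integral_cong)
      (auto simp: centered_indicator_def indicator_def algebra_simps)
  also have "\<dots> = cdf \<mu> t * (1 - cdf \<mu> u)"
    using \<mu>.prob_space by (simp add: cdf_def algebra_simps)
  finally show ?thesis .
qed

lemma integrable_centered_indicator_mult [simp]: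
  "integrable \<mu> (\<lambda>x. centered_indicator t x * centered_indicator u x)"
  by (rule \<mu>.integrable_const_bound[of _ "1 * 1"])
    (auto simp: abs_mult abs_centered_indicator_le intro!: mult_le_one)

text \<open>For \<open>t \<le> u\<close> the difference is, up to centering, the indicator of the
  interval between the points; with \<open>D\<close> its probability, the variance is
  \<open>D - D\<^sup>2\<close>. Fluctuations at nearby points are therefore nearly equal.\<close>

lemma second_moment_centered_indicator_diff:
  "(LINT x|\<mu>. (centered_indicator t x - centered_indicator u x)\<^sup>2) \<le> \<bar>cdf \<mu> t - cdf \<mu> u\<bar>"
proof (induction t u rule: linorder_wlog)
  case (le t u)
  have "(LINT x|\<mu>. (centered_indicator t x - centered_indicator u x)\<^sup>2) =
      (LINT x|\<mu>. centered_indicator t x * centered_indicator t x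
        - 2 * (centered_indicator t x * centered_indicator u x)
        + centered_indicator u x * centered_indicator u x)"
    by (simp add: power2_eq_square algebra_simps)
  also have "\<dots> = cdf \<mu> t * (1 - cdf \<mu> t) - 2 * (cdf \<mu> t * (1 - cdf \<mu> u)) + cdf \<mu> u * (1 - cdf \<mu> u)"
    using le by (simp add: integral_centered_indicator_mult)
  also have "\<dots> = (cdf \<mu> u - cdf \<mu> t) - (cdf \<mu> u - cdf \<mu> t)\<^sup>2"
    by (simp add: power2_eq_square algebra_simps)
  also have "\<dots> \<le> \<bar>cdf \<mu> t - cdf \<mu> u\<bar>"
    using zero_le_power2[of "cdf \<mu> u - cdf \<mu> t"] by linarith
  finally show ?case .
next
  case (sym t u)
  then show ?case by (simp add: power2_commute abs_minus_commute)
qed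

lemma count_eq_centered_indicator_sum:
  "real (card {j. j < n \<and> Y j \<omega> \<le> t}) = real n * cdf \<mu> t - (\<Sum>j<n. centered_indicator t (Y j \<omega>))"
  by (simp add: centered_indicator_def sum_subtractf indicator_def sum.If_cases Int_def)

text \<open>The level-set comparison is applied with the empirical fluctuation at the moving point
  \<open>u y k\<close> as \<open>Z y\<close> and the one at \<open>q\<close> as \<open>W\<close>.
  The condition \<open>i_lim\<close> says that the rank fraction misses \<open>cdf \<mu> q\<close>
  by less than the order of \<open>1 / sqrt n\<close>, so it leaves no bias in the limit.\<close>

lemma order_stat_linearization:
  assumes F: "(cdf \<mu> has_real_derivative d) (at q)" and "0 < d"
    and n: "filterlim n at_top sequentially"
    and i: "\<forall>\<^sub>F k in sequentially. 1 \<le> i k \<and> i k \<le> n k"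
    and i_meas: "\<And>k. (\<lambda>\<omega>. order_stat (i k) (n k) (\<lambda>j. Y j \<omega>)) \<in> borel_measurable M"
    and i_lim: "(\<lambda>k. sqrt (n k) * (i k / n k - cdf \<mu> q)) \<longlonglongrightarrow> 0"
  shows "bounded_in_prob (\<lambda>k \<omega>. sqrt (n k) * (order_stat (i k) (n k) (\<lambda>j. Y j \<omega>) - q))"
    and "vanishes_in_prob (\<lambda>k \<omega>. sqrt (n k) * (order_stat (i k) (n k) (\<lambda>j. Y j \<omega>) - q)
      - (\<Sum>j<n k. centered_indicator q (Y j \<omega>)) / (sqrt (n k) * d))"
proof -
  define V where "V k \<omega> = sqrt (n k) * (order_stat (i k) (n k) (\<lambda>j. Y j \<omega>) - q)" for k \<omega>
  define W where "W t k \<omega> = (\<Sum>j<n k. centered_indicator t (Y j \<omega>)) / (sqrt (n k) * d)" for t k \<omega>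
  define u where "u y k = q + y / sqrt (n k)" for y k
  \<comment> \<open>The threshold obtained by solving the counting inequality at
    \<open>u y k\<close> for the normalized fluctuation.\<close>
  define c where "c y k = sqrt (n k) * (cdf \<mu> (u y k) - i k / n k) / d" for y k
  have n': "filterlim (\<lambda>k. sqrt (n k)) at_top sequentially"
    by (intro filterlim_compose[OF sqrt_at_top] filterlim_compose[OF filterlim_real_sequentially] n)
  have n0: "\<forall>\<^sub>F k in sequentially. 0 < n k"
    using n[unfolded filterlim_at_top, rule_format, of 1] by eventually_elim simp
  have V[measurable]: "V k \<in> borel_measurable M" for k
    unfolding V_def using i_meas[of k] by measurable
  have W[measurable]: "W t k \<in> borel_measurable M" for t k
    unfolding W_def by measurable
  have u: "u y \<longlonglongrightarrow> q" for y
    unfolding u_def using tendsto_add[OF tendsto_const tendsto_divide_0[OF tendsto_const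
      filterlim_at_top_imp_at_infinity[OF n']]] by simp
  have isCont: "isCont (cdf \<mu>) q" using F by (rule DERIV_isCont)

  \<comment> \<open>Used twice: with one centered indicator for tightness of \<open>W q\<close>, and
    with a difference of two for the comparison of \<open>W (u y k)\<close> with
    \<open>W q\<close>.\<close>
  have moment: "integrable M (\<lambda>\<omega>. ((\<Sum>j<m. h (Y j \<omega>)) / (sqrt m * d))\<^sup>2)"
      "expectation (\<lambda>\<omega>. ((\<Sum>j<m. h (Y j \<omega>)) / (sqrt m * d))\<^sup>2) \<le> (LINT x|\<mu>. (h x)\<^sup>2) / d\<^sup>2"
    if h: "h \<in> borel_measurable borel" "\<And>x. \<bar>h x\<bar> \<le> B" "(LINT x|\<mu>. h x) = 0" for h B m
    using second_moment_sum[OF h, of m] \<open>0 < d\<close>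
    by (auto simp: power_divide power_mult_distrib)
  have bdd: "bounded_in_prob (W q)"
    unfolding W_def
    by (rule bounded_in_prob_second_moment)
      (measurable, (rule moment[OF _ abs_centered_indicator_le]; simp)+)

  have WW: "vanishes_in_prob (\<lambda>k \<omega>. W (u y k) k \<omega> - W q k \<omega>)" for y
  proof -
    define h where "h k x = centered_indicator (u y k) x - centered_indicator q x" for k x
    have h: "h k \<in> borel_measurable borel" "\<bar>h k x\<bar> \<le> 2" "(LINT x|\<mu>. h k x) = 0" for k x
      unfolding h_def using abs_centered_indicator_le[of "u y k" x] abs_centered_indicator_le[of q x]
      by auto
    have lim: "(\<lambda>k. \<bar>cdf \<mu> (u y k) - cdf \<mu> q\<bar> / d\<^sup>2) \<longlonglongrightarrow> 0"
      by (intro tendsto_divide_zero tendsto_rabs_zero LIM_zero isCont_tendsto_compose[OF isCont u])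
    have "vanishes_in_prob (\<lambda>k \<omega>. (\<Sum>j<n k. h k (Y j \<omega>)) / (sqrt (n k) * d))"
    proof (rule vanishes_in_prob_second_moment)
      show "(\<lambda>k. expectation (\<lambda>\<omega>. ((\<Sum>j<n k. h k (Y j \<omega>)) / (sqrt (n k) * d))\<^sup>2)) \<longlonglongrightarrow> 0"
      proof (rule tendsto_sandwich[OF _ _ tendsto_const lim]; intro always_eventually allI)
        fix k
        have "expectation (\<lambda>\<omega>. ((\<Sum>j<n k. h k (Y j \<omega>)) / (sqrt (n k) * d))\<^sup>2) \<le> (LINT x|\<mu>. (h k x)\<^sup>2) / d\<^sup>2"
          using moment(2)[OF h] .
        also have "\<dots> \<le> \<bar>cdf \<mu> (u y k) - cdf \<mu> q\<bar> / d\<^sup>2"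
          unfolding h_def by (intro divide_right_mono second_moment_centered_indicator_diff) simp
        finally show "expectation (\<lambda>\<omega>. ((\<Sum>j<n k. h k (Y j \<omega>)) / (sqrt (n k) * d))\<^sup>2)
            \<le> \<bar>cdf \<mu> (u y k) - cdf \<mu> q\<bar> / d\<^sup>2" .
      qed simp
      show "integrable M (\<lambda>\<omega>. ((\<Sum>j<n k. h k (Y j \<omega>)) / (sqrt (n k) * d))\<^sup>2)" for k
        using moment(1)[OF h] .
      have [measurable]: "h k \<in> borel_measurable borel" for k by (rule h)
      show "(\<lambda>\<omega>. (\<Sum>j<n k. h k (Y j \<omega>)) / (sqrt (n k) * d)) \<in> borel_measurable M" for k
        by measurable
    qed
    then show ?thesis
      by (simp add: W_def h_def sum_subtractf diff_divide_distrib)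
  qed

  have c: "c y \<longlonglongrightarrow> y" for y
  proof -
    have slope: "(\<lambda>k. sqrt (n k) * (cdf \<mu> (u y k) - cdf \<mu> q)) \<longlonglongrightarrow> y * d"
    \<comment> \<open>The derivative is evaluated along the null sequence
      \<open>y / sqrt (n k)\<close>, which must avoid 0; for \<open>y = 0\<close> both sides are
      0.\<close>
    proof (cases "y = 0")
      case False
      have "((\<lambda>h. (cdf \<mu> (q + h) - cdf \<mu> q) / h) \<longlongrightarrow> d) (at 0)"
        using F by (simp add: DERIV_def)
      moreover have "filterlim (\<lambda>k. y / sqrt (n k)) (at 0) sequentially"
        unfolding filterlim_at
      proof
        show "\<forall>\<^sub>F k in sequentially. y / sqrt (real (n k)) \<in> UNIV \<and> y / sqrt (real (n k)) \<noteq> 0"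
          using n0 by eventually_elim (simp add: False)
        show "(\<lambda>k. y / sqrt (n k)) \<longlonglongrightarrow> 0"
          by (intro tendsto_divide_0[OF tendsto_const] filterlim_at_top_imp_at_infinity n')
      qed
      ultimately have "(\<lambda>k. y * ((cdf \<mu> (q + y / sqrt (n k)) - cdf \<mu> q) / (y / sqrt (n k)))) \<longlonglongrightarrow> y * d"
        by (intro tendsto_mult tendsto_const) (rule filterlim_compose)
      then show ?thesis using False by (simp add: u_def mult.commute)
    qed (simp add: u_def)
    have "(\<lambda>k. (sqrt (n k) * (cdf \<mu> (u y k) - cdf \<mu> q) - sqrt (n k) * (i k / n k - cdf \<mu> q)) / d)
        \<longlonglongrightarrow> (y * d - 0) / d"
      using \<open>0 < d\<close> by (intro tendsto_intros slope i_lim) simp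
    also have "(\<lambda>k. (sqrt (n k) * (cdf \<mu> (u y k) - cdf \<mu> q) - sqrt (n k) * (i k / n k - cdf \<mu> q)) / d) = c y"
      by (simp add: fun_eq_iff c_def algebra_simps)
    finally show ?thesis using \<open>0 < d\<close> by simp
  qed

  have level: "\<forall>\<^sub>F k in sequentially. \<forall>\<omega>\<in>space M. V k \<omega> \<le> y \<longleftrightarrow> W (u y k) k \<omega> \<le> c y k" for y
    using n0 i
  proof eventually_elim
    case (elim k)
    show ?case
    proof
      fix \<omega>
      have "V k \<omega> \<le> y \<longleftrightarrow> order_stat (i k) (n k) (\<lambda>j. Y j \<omega>) \<le> u y k"
        using elim by (simp add: V_def u_def field_simps)
      also have "\<dots> \<longleftrightarrow> i k \<le> card {j. j < n k \<and> Y j \<omega> \<le> u y k}"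
        using elim by (simp add: order_stat_le_iff)
      \<comment> \<open>The count equals \<open>n F(u)\<close> minus the sum of centered indicators,
        so the rank condition is an upper bound on that sum; dividing by
        \<open>sqrt n * d > 0\<close> then gives \<open>W \<le> c\<close>.\<close>
      also have "\<dots> \<longleftrightarrow> (\<Sum>j<n k. centered_indicator (u y k) (Y j \<omega>)) \<le> n k * cdf \<mu> (u y k) - i k"
        using count_eq_centered_indicator_sum[of "n k" \<omega> "u y k"] by linarith
      also have "n k * cdf \<mu> (u y k) - i k = c y k * (sqrt (n k) * d)"
        using elim \<open>0 < d\<close> by (simp add: c_def field_simps)
      also have "(\<Sum>j<n k. centered_indicator (u y k) (Y j \<omega>)) \<le> \<dots> \<longleftrightarrow> W (u y k) k \<omega> \<le> c y k"
        using elim \<open>0 < d\<close> by (simp add: W_def pos_divide_le_eq)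
      finally show "V k \<omega> \<le> y \<longleftrightarrow> W (u y k) k \<omega> \<le> c y k" .
    qed
  qed

  have vanish: "vanishes_in_prob (\<lambda>k \<omega>. V k \<omega> - W q k \<omega>)"
    by (rule vanishes_in_prob_level_sets[OF V W _ bdd WW c level]) measurable
  then show "vanishes_in_prob (\<lambda>k \<omega>. sqrt (n k) * (order_stat (i k) (n k) (\<lambda>j. Y j \<omega>) - q)
      - (\<Sum>j<n k. centered_indicator q (Y j \<omega>)) / (sqrt (n k) * d))"
    by (simp add: V_def W_def)
  have "bounded_in_prob (\<lambda>k \<omega>. (V k \<omega> - W q k \<omega>) + W q k \<omega>)"
    by (intro bounded_in_prob_add bounded_in_prob_of_vanishes vanish bdd) measurable
  then show "bounded_in_prob (\<lambda>k \<omega>. sqrt (n k) * (order_stat (i k) (n k) (\<lambda>j. Y j \<omega>) - q))"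
    by (simp add: V_def)
qed

end

section \<open>Quantiles\<close>

context real_distribution
begin

text \<open>The Galois connection between a distribution function and its quantile function. The
  limits at both ends make the defining set nonempty and bounded below, and right continuity makes
  its infimum attained.\<close>

lemma quantile_le_iff:
  assumes p: "0 < p" "p < 1"
  shows "quantile (cdf M) p \<le> x \<longleftrightarrow> p \<le> cdf M x"
proof -
  let ?S = "{x. p \<le> cdf M x}"
  have "\<forall>\<^sub>F x in at_top. p < cdf M x"
    using cdf_lim_at_top_prob p by (rule_tac order_tendstoD(1))
  then obtain u where u: "p \<le> cdf M u"
    by (metis eventually_at_top_linorder less_imp_le order_refl)
  have "\<forall>\<^sub>F x in at_bot. cdf M x < p"
    using cdf_lim_at_bot p by (rule_tac order_tendstoD(2))
  then obtain l where l: "cdf M l < p"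
    by (metis eventually_at_bot_linorder order_refl)
  have bdd: "bdd_below ?S"
    by (rule bdd_belowI[of _ l]) (metis cdf_nondecreasing l leD linorder_le_cases mem_Collect_eq order_trans)
  show ?thesis
  proof
    assume "p \<le> cdf M x"
    then show "quantile (cdf M) p \<le> x"
      unfolding quantile_def by (intro cInf_lower bdd) simp
  next
    assume q: "quantile (cdf M) p \<le> x"
    have "p \<le> cdf M y" if "x < y" for y
    proof -
      have "Inf ?S < y" using q that unfolding quantile_def by simp
      then obtain z where "z \<in> ?S" "z < y" using u cInf_lessD[of ?S y] by auto
      then show ?thesis using cdf_nondecreasing[of z y] by auto
    qed
    then have "\<forall>\<^sub>F y in at_right x. p \<le> cdf M y"
      unfolding eventually_at_filter by (auto intro: always_eventually)
    moreover have "(cdf M \<longlongrightarrow> cdf M x) (at_right x)"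
      using cdf_is_right_cont[of x] by (simp add: continuous_within)
    ultimately show "p \<le> cdf M x"
      by (intro tendsto_lowerbound[of "cdf M"]) auto
  qed
qed

text \<open>One inequality is the Galois connection at the quantile itself. For the other, the
  values to the left are below \<open>p\<close>, and continuity carries this bound to the
  quantile.\<close>

lemma cdf_quantile:
  assumes p: "0 < p" "p < 1" and cont: "isCont (cdf M) (quantile (cdf M) p)"
  shows "cdf M (quantile (cdf M) p) = p"
proof (rule antisym)
  let ?q = "quantile (cdf M) p"
  show "p \<le> cdf M ?q" using quantile_le_iff[OF p, of ?q] by simp
  have "cdf M x \<le> p" if "x < ?q" for x
    using quantile_le_iff[OF p, of x] that by auto
  then have "\<forall>\<^sub>F x in at_left ?q. cdf M x \<le> p"
    unfolding eventually_at_filter by (auto intro: always_eventually)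
  moreover have "(cdf M \<longlongrightarrow> cdf M ?q) (at_left ?q)"
    using cont by (simp add: isCont_def filterlim_at_split)
  ultimately show "cdf M ?q \<le> p"
    by (intro tendsto_upperbound[of "cdf M"]) auto
qed

text \<open>The inverse function rule requires continuity of the quantile function at
  \<open>p\<close>. Its lower half follows from the Galois connection; its upper half needs the
  distribution function to exceed \<open>p\<close> immediately to the right of the quantile, which
  the positive derivative ensures.\<close>

lemma quantile_has_real_derivative:
  assumes p: "0 < p" "p < 1" and cont: "\<And>x. isCont (cdf M) x"
    and d: "(cdf M has_real_derivative d) (at (quantile (cdf M) p))" "0 < d"
  shows "(quantile (cdf M) has_real_derivative inverse d) (at p)"
proof (rule DERIV_inverse_function[of "cdf M"])
  let ?q = "quantile (cdf M) p"
  show "cdf M (quantile (cdf M) y) = y" if "0 < y" "y < 1" for y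
    using that cont by (rule cdf_quantile)
  have q: "cdf M ?q = p" using p cont by (rule cdf_quantile)
  show "isCont (quantile (cdf M)) p"
    unfolding isCont_def
  proof (rule order_tendstoI)
    fix a assume "a < ?q"
    then have "cdf M a < p" using quantile_le_iff[OF p, of a] by auto
    \<comment> \<open>The bounds 0 and 1 keep \<open>y\<close> in the range where the Galois
      connection applies.\<close>
    then have "\<forall>\<^sub>F y in at p. y \<in> {max 0 (cdf M a)<..<1}"
      using p by (intro eventually_at_in_open') auto
    then show "\<forall>\<^sub>F y in at p. a < quantile (cdf M) y"
      by eventually_elim (use quantile_le_iff in \<open>auto simp: not_le[symmetric]\<close>)
  next
    fix a assume a: "?q < a"
    obtain \<delta> where \<delta>: "0 < \<delta>" "\<And>h. 0 < h \<Longrightarrow> h < \<delta> \<Longrightarrow> cdf M ?q < cdf M (?q + h)"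
      using DERIV_pos_inc_right[OF d] by auto
    define h where "h = min (\<delta> / 2) ((a - ?q) / 2)"
    have h: "0 < h" "h < \<delta>" using \<delta>(1) a by (auto simp: h_def min_less_iff_disj)
    have "h \<le> (a - ?q) / 2" unfolding h_def by (rule min.cobounded2)
    also have "\<dots> < a - ?q" using a by simp
    finally have h_a: "?q + h < a" by simp
    have "p < cdf M (?q + h)" using \<delta>(2)[OF h] q by simp
    then have "\<forall>\<^sub>F y in at p. y \<in> {0<..<min 1 (cdf M (?q + h))}"
      using p by (intro eventually_at_in_open') auto
    then show "\<forall>\<^sub>F y in at p. quantile (cdf M) y < a"
    proof eventually_elim
      case (elim y)
      then have "quantile (cdf M) y \<le> ?q + h" by (subst quantile_le_iff) auto
      with h_a show ?case by simp
    qed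
  qed
qed (use p d in auto)

end

text \<open>The library's real \<open>ln\<close> is \<open>ln \<bar>x\<bar>\<close> for \<open>x \<noteq> 0\<close>, so negative quantiles need no separate treatment.\<close>

lemma has_real_derivative_ln_nonzero:
  fixes x :: real
  assumes "x \<noteq> 0"
  shows "(ln has_real_derivative inverse x) (at x)"
proof (cases "0 < x")
  case False
  then have "((\<lambda>x. ln (- x)) has_real_derivative inverse x) (at x)"
    using assms by (auto intro!: derivative_eq_intros simp: field_simps)
  then show ?thesis by (simp add: ln_minus)
qed (rule DERIV_ln)

section \<open>The normal limit\<close>

lemma std_normal_cdf_rescale:
  assumes "0 < v"
  shows "cdf (normal_distr 0 v) x = cdf std_normal_distribution (x / sqrt v)"
proof -
  interpret S: prob_space "normal_distr 0 v"
    unfolding normal_distr_def using assms by (intro prob_space_normal_density) simp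
  have "distributed (normal_distr 0 v) lborel (\<lambda>x. x) (\<lambda>x. ennreal (normal_density 0 (sqrt v) x))"
    unfolding normal_distr_def distributed_def by (auto simp: distr_id2)
  then have "distributed (normal_distr 0 v) lborel (\<lambda>x. (x - 0) / sqrt v) std_normal_density"
    by (subst S.normal_standard_normal_convert[symmetric]) (use assms in auto)
  then have "std_normal_distribution = distr (normal_distr 0 v) lborel (\<lambda>x. x / sqrt v)"
    by (simp add: distributed_def)
  also have "cdf \<dots> (x / sqrt v) = cdf (normal_distr 0 v) x"
    unfolding cdf_def using assms
    by (subst measure_distr) (auto simp: normal_distr_def divide_le_cancel intro!: arg_cong2[where f = measure])
  finally show ?thesis ..
qed

lemma isCont_cdf_normal_distr:
  assumes "0 < v"
  shows "isCont (cdf (normal_distr 0 v)) x"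
proof -
  interpret S: prob_space "normal_distr 0 v"
    unfolding normal_distr_def using assms by (intro prob_space_normal_density) simp
  interpret S: finite_borel_measure "normal_distr 0 v"
    by standard (simp add: normal_distr_def)
  have "emeasure (normal_distr 0 v) {x} = 0"
    unfolding normal_distr_def by (simp add: emeasure_density nn_integral_indicator_singleton)
  then show ?thesis by (simp add: S.isCont_cdf measure_def)
qed

text \<open>The classical theorem normalizes to variance 1; its conclusion is read at
  \<open>x / sqrt v\<close> and scaled back. The normal distribution function is continuous, so
  convergence holds at every \<open>x\<close>.\<close>

lemma (in iid_sequence) central_limit_bounded:
  fixes h :: "real \<Rightarrow> real"
  assumes h [measurable]: "h \<in> borel_measurable borel" and B: "\<And>x. \<bar>h x\<bar> \<le> B"
    and zero: "(LINT x|\<mu>. h x) = 0" and v: "(LINT x|\<mu>. (h x)\<^sup>2) = v" "0 < v"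
  shows "(\<lambda>n. cdf (distr M borel (\<lambda>\<omega>. (\<Sum>j<n. h (Y j \<omega>)) / sqrt n)) x) \<longlonglongrightarrow> cdf (normal_distr 0 v) x"
proof -
  have "weak_conv_m (\<lambda>n. distr M borel (\<lambda>\<omega>. (\<Sum>j<n. h (Y j \<omega>)) / sqrt (n * (sqrt v)\<^sup>2))) std_normal_distribution"
  proof (rule central_limit_theorem_zero_mean[where \<mu> = "distr \<mu> borel h"])
    show "indep_vars (\<lambda>i. borel) (\<lambda>j \<omega>. h (Y j \<omega>)) UNIV"
      by (rule indep_vars_compose2[OF indep]) auto
    show E: "expectation (\<lambda>\<omega>. h (Y n \<omega>)) = 0" for n
      by (simp add: expectation_Y zero)
    show "0 < sqrt v" using v by simp
    show "integrable M (\<lambda>\<omega>. (h (Y n \<omega>))\<^sup>2)" for n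
    proof (rule integrable_const_bound[of _ "B\<^sup>2"])
      show "AE \<omega> in M. norm ((h (Y n \<omega>))\<^sup>2) \<le> B\<^sup>2"
        using B by (auto intro!: AE_I2) (metis abs_ge_zero power2_abs power_mono)
    qed measurable
    show "expectation (\<lambda>\<omega>. (h (Y n \<omega>) - expectation (\<lambda>\<omega>. h (Y n \<omega>)))\<^sup>2) = (sqrt v)\<^sup>2" for n
      using v by (simp add: E expectation_Y[of "\<lambda>x. (h x)\<^sup>2"])
    show "distr M borel (\<lambda>\<omega>. h (Y n \<omega>)) = distr \<mu> borel h" for n
      unfolding distr_Y[of n, symmetric] by (subst distr_distr) (auto simp: comp_def)
  qed
  moreover have "isCont (cdf std_normal_distribution) y" for y
    using isCont_cdf_normal_distr[of 1 y] by (simp add: normal_distr_def)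
  ultimately have lim: "(\<lambda>n. cdf (distr M borel (\<lambda>\<omega>. (\<Sum>j<n. h (Y j \<omega>)) / sqrt (n * (sqrt v)\<^sup>2))) (x / sqrt v))
      \<longlonglongrightarrow> cdf std_normal_distribution (x / sqrt v)"
    by (simp add: weak_conv_m_def weak_conv_def)
  have "cdf (distr M borel (\<lambda>\<omega>. (\<Sum>j<n. h (Y j \<omega>)) / sqrt (n * (sqrt v)\<^sup>2))) (x / sqrt v) =
      cdf (distr M borel (\<lambda>\<omega>. (\<Sum>j<n. h (Y j \<omega>)) / sqrt n)) x" for n
    unfolding cdf_def using v
    by (subst (1 2) measure_distr)
      (auto simp: real_sqrt_mult simp flip: divide_divide_eq_left intro!: arg_cong2[where f = measure] divide_right_mono
        simp: divide_le_cancel)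
  with lim show ?thesis using v by (simp add: std_normal_cdf_rescale)
qed

section \<open>Limit law of the log ratio of two order statistics\<close>

context iid_sequence
begin

text \<open>The delta method for \<open>ln\<close> multiplies the linearization by
  \<open>1 / q\<close>, which turns the scale \<open>d\<close> into \<open>q * d\<close>; this is
  where the coefficients \<open>a\<close> and \<open>b\<close> come from.\<close>

lemma log_order_stat_linearization:
  assumes F: "(cdf \<mu> has_real_derivative d) (at q)" and "0 < d" and "q \<noteq> 0"
    and n: "filterlim n at_top sequentially"
    and i: "\<forall>\<^sub>F k in sequentially. 1 \<le> i k \<and> i k \<le> n k"
    and i_meas [measurable]: "\<And>k. (\<lambda>\<omega>. order_stat (i k) (n k) (\<lambda>j. Y j \<omega>)) \<in> borel_measurable M"
    and i_lim: "(\<lambda>k. sqrt (n k) * (i k / n k - cdf \<mu> q)) \<longlonglongrightarrow> 0"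
  shows "vanishes_in_prob (\<lambda>k \<omega>. order_stat (i k) (n k) (\<lambda>j. Y j \<omega>) - q)"
    and "vanishes_in_prob (\<lambda>k \<omega>. sqrt (n k) * (ln (order_stat (i k) (n k) (\<lambda>j. Y j \<omega>)) - ln q)
      - (\<Sum>j<n k. centered_indicator q (Y j \<omega>) / (q * d)) / sqrt (n k))"
proof -
  define U where "U k \<omega> = order_stat (i k) (n k) (\<lambda>j. Y j \<omega>)" for k \<omega>
  have U [measurable]: "U k \<in> borel_measurable M" for k unfolding U_def by measurable
  note lin = order_stat_linearization[OF F \<open>0 < d\<close> n i i_meas i_lim, folded U_def]
  have n': "filterlim (\<lambda>k. sqrt (n k)) at_top sequentially"
    by (intro filterlim_compose[OF sqrt_at_top] filterlim_compose[OF filterlim_real_sequentially] n)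
  note delta = delta_method[OF has_real_derivative_ln_nonzero[OF \<open>q \<noteq> 0\<close>] _ U n' lin(1)]
  show "vanishes_in_prob (\<lambda>k \<omega>. order_stat (i k) (n k) (\<lambda>j. Y j \<omega>) - q)"
    using delta(1) by (simp add: U_def)
  have "vanishes_in_prob (\<lambda>k \<omega>. (sqrt (n k) * (ln (U k \<omega>) - ln q) - inverse q * (sqrt (n k) * (U k \<omega> - q)))
      + inverse q * (sqrt (n k) * (U k \<omega> - q)
        - (\<Sum>j<n k. centered_indicator q (Y j \<omega>)) / (sqrt (n k) * d)))"
    by (intro vanishes_in_prob_add delta(2) vanishes_in_prob_cmult lin(2)) measurable
  also have "(\<lambda>k \<omega>. (sqrt (n k) * (ln (U k \<omega>) - ln q) - inverse q * (sqrt (n k) * (U k \<omega> - q)))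
      + inverse q * (sqrt (n k) * (U k \<omega> - q)
        - (\<Sum>j<n k. centered_indicator q (Y j \<omega>)) / (sqrt (n k) * d))) =
    (\<lambda>k \<omega>. sqrt (n k) * (ln (U k \<omega>) - ln q)
      - (\<Sum>j<n k. centered_indicator q (Y j \<omega>) / (q * d)) / sqrt (n k))"
    by (simp add: fun_eq_iff right_diff_distrib divide_inverse mult.assoc mult.left_commute mult.commute
        flip: sum_divide_distrib sum_distrib_left sum_distrib_right)
  finally show "vanishes_in_prob (\<lambda>k \<omega>. sqrt (n k) * (ln (order_stat (i k) (n k) (\<lambda>j. Y j \<omega>)) - ln q)
      - (\<Sum>j<n k. centered_indicator q (Y j \<omega>) / (q * d)) / sqrt (n k))"
    by (simp add: U_def)
qed

text \<open>Both log order statistics linearize to sums over the same observations, so their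
  difference is a single normalized sum of independent terms. The covariance of the two quantiles is
  contained in the variance of one summand.\<close>

lemma T_stat_asymptotically_normal:
  fixes f :: "real \<Rightarrow> real"
  defines "F \<equiv> cdf \<mu>"
  assumes s: "2 \<le> s" and cont: "\<And>x. isCont F x"
    and f_low: "(F has_real_derivative f (quantile F (p_low s))) (at (quantile F (p_low s)))"
    and f_high: "(F has_real_derivative f (quantile F (p_high s))) (at (quantile F (p_high s)))"
    and f_low_pos: "0 < f (quantile F (p_low s))"
    and f_high_pos: "0 < f (quantile F (p_high s))"
    and q_low: "quantile F (p_low s) \<noteq> 0" and q_high: "quantile F (p_high s) \<noteq> 0"
  shows "(\<lambda>k. cdf (distr M borel (\<lambda>\<omega>. T_stat F s k (\<lambda>i. Y i \<omega>))) x) \<longlonglongrightarrow> cdf (normal_distr 0 (asym_var F f s)) x"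
proof -
  define q1 q2 where "q1 = quantile F (p_low s)" and "q2 = quantile F (p_high s)"
  define a b where "a = a_coeff F f s" and "b = b_coeff F f s"
  have a: "a = q1 * f q1" "a \<noteq> 0" and b: "b = q2 * f q2" "b \<noteq> 0"
    using f_low_pos f_high_pos q_low q_high by (simp_all add: a_def b_def a_coeff_def b_coeff_def q1_def q2_def)
  have p: "0 < p_low s" "p_low s < 1" "0 < p_high s" "p_high s < 1" "p_low s \<le> p_high s"
    using s by (simp_all add: p_low_def p_high_def divide_right_mono)
  have F: "F q1 = p_low s" "F q2 = p_high s"
    unfolding q1_def q2_def F_def using p cont by (auto intro!: \<mu>.cdf_quantile simp: F_def)
  \<comment> \<open>Fixes the order of the two points, so that the covariance below is
    \<open>F q1 * (1 - F q2)\<close>.\<close>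
  have "q1 \<le> q2"
    using p F(2) unfolding q1_def F_def by (subst \<mu>.quantile_le_iff) auto

  define n where "n k = (s + 1) * k - 1" for k
  have n_ge: "k \<le> n k" "real (n k) = (real s + 1) * real k - 1" if "1 \<le> k" for k
  proof -
    have "1 * k + 1 * k \<le> s * k + 1 * k" using s by (intro add_mono mult_le_mono1) auto
    then show "k \<le> n k" using that unfolding n_def distrib_right by linarith
    have "1 \<le> (s + 1) * k" using that by (simp add: Suc_le_eq)
    then show "real (n k) = (real s + 1) * real k - 1" by (simp add: n_def of_nat_diff algebra_simps)
  qed
  have n_at_top: "filterlim n at_top sequentially"
    by (rule filterlim_at_top_mono[OF filterlim_ident]) (use n_ge in \<open>auto intro: eventually_sequentiallyI[of 1]\<close>)
  have n': "filterlim (\<lambda>k. sqrt (n k)) at_top sequentially"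
    by (intro filterlim_compose[OF sqrt_at_top] filterlim_compose[OF filterlim_real_sequentially] n_at_top)
  have i_range: "1 \<le> k * m \<and> k * m \<le> n k" if "1 \<le> k" "1 \<le> m" "m \<le> s" for k m
  proof -
    have "k * m + 1 \<le> k * s + k" using that by (intro add_mono mult_le_mono) auto
    then show ?thesis using that by (simp add: n_def algebra_simps)
  qed
  have i_meas: "(\<lambda>\<omega>. order_stat (k * m) (n k) (\<lambda>j. Y j \<omega>)) \<in> borel_measurable M"
    if "1 \<le> m" "m \<le> s" for k m
  \<comment> \<open>For \<open>k = 0\<close> the sorted list is empty, and indexing it yields a
    value that does not depend on \<omega>.\<close>
  proof (cases "k = 0")
    case True
    then show ?thesis by (simp add: n_def order_stat_def)
  next
    case False
    then show ?thesis using i_range[of k m] that by (intro order_stat_measurable) auto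
  qed
  \<comment> \<open>Because \<open>n = (s + 1) k - 1\<close>, the rank fraction
    \<open>k m / n\<close> exceeds \<open>m / (s + 1)\<close> by exactly
    \<open>m / ((s + 1) n)\<close>, which vanishes even after scaling by
    \<open>sqrt n\<close>.\<close>
  have i_lim: "(\<lambda>k. sqrt (n k) * (real (k * m) / n k - real m / (real s + 1))) \<longlonglongrightarrow> 0" for m
  proof (rule Lim_transform_eventually)
    show "(\<lambda>k. (real m / (real s + 1)) / sqrt (n k)) \<longlonglongrightarrow> 0"
      by (intro tendsto_divide_0[OF tendsto_const] filterlim_at_top_imp_at_infinity n')
    have "(real m / (real s + 1)) / sqrt (n k) = sqrt (n k) * (real (k * m) / n k - real m / (real s + 1))"
      if "1 \<le> k" for k
    proof -
      have "0 < real (n k)" using n_ge(1)[OF that] that by simp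
      then have "real (k * m) / n k - real m / (real s + 1) = real m / (real s + 1) / n k"
        using n_ge(2)[OF that] by (simp add: divide_simps) (simp add: algebra_simps)
      then show ?thesis using \<open>0 < real (n k)\<close>
        by (simp add: real_div_sqrt divide_simps flip: real_sqrt_mult)
    qed
    then show "\<forall>\<^sub>F k in sequentially. (real m / (real s + 1)) / sqrt (n k)
        = sqrt (n k) * (real (k * m) / n k - real m / (real s + 1))"
      by (auto intro: eventually_sequentiallyI[of 1])
  qed

  define X1 X2 where "X1 k \<omega> = order_stat k (n k) (\<lambda>j. Y j \<omega>)"
    and "X2 k \<omega> = order_stat (k * s) (n k) (\<lambda>j. Y j \<omega>)" for k \<omega>
  have [measurable]: "X1 k \<in> borel_measurable M" "X2 k \<in> borel_measurable M" for k
    unfolding X1_def X2_def using i_meas[of 1 k] i_meas[of s k] s by auto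
  \<comment> \<open>Serves both ranks: \<open>m = 1\<close> for the lower order statistic and
    \<open>m = s\<close> for the upper one.\<close>
  have lin: "vanishes_in_prob (\<lambda>k \<omega>. order_stat (k * m) (n k) (\<lambda>j. Y j \<omega>) - q)"
      "vanishes_in_prob (\<lambda>k \<omega>. sqrt (n k) * (ln (order_stat (k * m) (n k) (\<lambda>j. Y j \<omega>)) - ln q)
        - (\<Sum>j<n k. centered_indicator q (Y j \<omega>) / (q * d)) / sqrt (n k))"
    if m: "1 \<le> m" "m \<le> s" and q: "F q = real m / (real s + 1)" "q \<noteq> 0"
      and d: "(F has_real_derivative d) (at q)" "0 < d" for m q d
  proof -
    have i: "\<forall>\<^sub>F k in sequentially. 1 \<le> k * m \<and> k * m \<le> n k"
      using i_range m by (blast intro: eventually_sequentiallyI[of 1])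
    have lim: "(\<lambda>k. sqrt (n k) * (real (k * m) / n k - cdf \<mu> q)) \<longlonglongrightarrow> 0"
      using i_lim[of m] q(1) by (simp only: F_def)
    show "vanishes_in_prob (\<lambda>k \<omega>. order_stat (k * m) (n k) (\<lambda>j. Y j \<omega>) - q)"
      "vanishes_in_prob (\<lambda>k \<omega>. sqrt (n k) * (ln (order_stat (k * m) (n k) (\<lambda>j. Y j \<omega>)) - ln q)
        - (\<Sum>j<n k. centered_indicator q (Y j \<omega>) / (q * d)) / sqrt (n k))"
      by (rule log_order_stat_linearization[OF d[unfolded F_def] q(2) n_at_top i i_meas[OF m] lim])+
  qed
  have q: "q1 \<noteq> 0" "q2 \<noteq> 0" using q_low q_high by (simp_all add: q1_def q2_def)
  have F': "F q1 = real 1 / (real s + 1)" "F q2 = real s / (real s + 1)"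
    unfolding F p_low_def p_high_def by simp_all
  have lin1: "vanishes_in_prob (\<lambda>k \<omega>. X1 k \<omega> - q1)"
      "vanishes_in_prob (\<lambda>k \<omega>. sqrt (n k) * (ln (X1 k \<omega>) - ln q1)
        - (\<Sum>j<n k. centered_indicator q1 (Y j \<omega>) / a) / sqrt (n k))"
    using lin[OF _ _ F'(1) q(1) f_low[folded q1_def] f_low_pos[folded q1_def]] s
    by (simp_all only: X1_def a mult_1_right le_refl one_le_numeral order_trans[OF one_le_numeral s])
  have lin2: "vanishes_in_prob (\<lambda>k \<omega>. X2 k \<omega> - q2)"
      "vanishes_in_prob (\<lambda>k \<omega>. sqrt (n k) * (ln (X2 k \<omega>) - ln q2)
        - (\<Sum>j<n k. centered_indicator q2 (Y j \<omega>) / b) / sqrt (n k))"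
    using lin[OF _ _ F'(2) q(2) f_high[folded q2_def] f_high_pos[folded q2_def]] s
    by (simp_all only: X2_def b le_refl order_trans[OF one_le_numeral s])

  define T where "T k \<omega> = T_stat F s k (\<lambda>i. Y i \<omega>)" for k \<omega>
  have T [measurable]: "T k \<in> borel_measurable M" for k
    unfolding T_def using s by (intro T_stat_measurable[OF Y_measurable]) simp
  \<comment> \<open>The error in replacing the logarithm of a quotient by a difference of
    logarithms. It can be nonzero only where an order statistic equals 0, and this is improbable
    since both limits are nonzero.\<close>
  define E where "E k \<omega> = T k \<omega> - (sqrt (n k) * (ln (X2 k \<omega>) - ln q2) - sqrt (n k) * (ln (X1 k \<omega>) - ln q1))" for k \<omega>
  have [measurable]: "E k \<in> borel_measurable M" for k unfolding E_def by measurable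
  have E_zero: "E k \<omega> = 0" if "X1 k \<omega> \<noteq> 0" "X2 k \<omega> \<noteq> 0" for k \<omega>
  proof -
    have "T k \<omega> = sqrt (n k) * (ln (X2 k \<omega> / X1 k \<omega>) - ln (q2 / q1))"
      by (simp only: T_def T_stat_def Let_def X1_def X2_def n_def q1_def q2_def)
    also have "\<dots> = sqrt (n k) * ((ln (X2 k \<omega>) - ln (X1 k \<omega>)) - (ln q2 - ln q1))"
      using that q by (simp only: ln_div simp_thms if_True)
    finally show ?thesis by (simp only: E_def) (simp add: algebra_simps)
  qed
  have E: "vanishes_in_prob E"
  proof (rule vanishes_in_probI)
    fix \<epsilon> \<eta> :: real assume "0 < \<epsilon>" "0 < \<eta>"
    \<comment> \<open>An order statistic equal to 0 deviates from its limit \<open>q\<close> by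
      \<open>\<bar>q\<bar>\<close>, hence by more than \<open>\<bar>q\<bar> / 2\<close>.\<close>
    have "\<forall>\<^sub>F k in sequentially. prob {\<omega> \<in> space M. \<bar>q1\<bar> / 2 < \<bar>X1 k \<omega> - q1\<bar>} < \<eta> / 2"
      using \<open>0 < \<eta>\<close> q by (intro vanishes_in_prob_bound[OF lin1(1)]) auto
    moreover have "\<forall>\<^sub>F k in sequentially. prob {\<omega> \<in> space M. \<bar>q2\<bar> / 2 < \<bar>X2 k \<omega> - q2\<bar>} < \<eta> / 2"
      using \<open>0 < \<eta>\<close> q by (intro vanishes_in_prob_bound[OF lin2(1)]) auto
    ultimately show "\<forall>\<^sub>F k in sequentially. prob {\<omega> \<in> space M. \<epsilon> < \<bar>E k \<omega>\<bar>} \<le> \<eta>"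
    proof eventually_elim
      case (elim k)
      have "prob {\<omega> \<in> space M. \<epsilon> < \<bar>E k \<omega>\<bar>} \<le> \<eta> / 2 + \<eta> / 2"
      proof (rule prob_le_two)
        show "{\<omega> \<in> space M. \<epsilon> < \<bar>E k \<omega>\<bar>} \<subseteq>
            {\<omega> \<in> space M. \<bar>q1\<bar> / 2 < \<bar>X1 k \<omega> - q1\<bar>} \<union> {\<omega> \<in> space M. \<bar>q2\<bar> / 2 < \<bar>X2 k \<omega> - q2\<bar>}"
        proof safe
          fix \<omega> assume "\<epsilon> < \<bar>E k \<omega>\<bar>" "\<not> \<bar>q2\<bar> / 2 < \<bar>X2 k \<omega> - q2\<bar>"
          then have "E k \<omega> \<noteq> 0" "X2 k \<omega> \<noteq> 0" using \<open>0 < \<epsilon>\<close> q by auto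
          then have "X1 k \<omega> = 0" using E_zero[of k \<omega>] by blast
          then show "\<bar>q1\<bar> / 2 < \<bar>X1 k \<omega> - q1\<bar>" using q by simp
        qed
      qed (use elim in auto)
      then show ?case by simp
    qed
  qed

  \<comment> \<open>The influence function of the log quantile ratio.\<close>
  define h where "h x = centered_indicator q2 x / b - centered_indicator q1 x / a" for x
  define S where "S k \<omega> = (\<Sum>j<n k. h (Y j \<omega>)) / sqrt (n k)" for k \<omega>
  have h [measurable]: "h \<in> borel_measurable borel" unfolding h_def by measurable
  have S [measurable]: "S k \<in> borel_measurable M" for k unfolding S_def by measurable
  \<comment> \<open>\<open>T - S\<close> is the splitting error plus the upper linearization error
    minus the lower one.\<close>
  have "vanishes_in_prob (\<lambda>k \<omega>. E k \<omega> + ((sqrt (n k) * (ln (X2 k \<omega>) - ln q2)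
        - (\<Sum>j<n k. centered_indicator q2 (Y j \<omega>) / b) / sqrt (n k))
      + (- 1) * (sqrt (n k) * (ln (X1 k \<omega>) - ln q1)
        - (\<Sum>j<n k. centered_indicator q1 (Y j \<omega>) / a) / sqrt (n k))))"
    by (intro vanishes_in_prob_add vanishes_in_prob_cmult E lin1 lin2) measurable
  then have TS: "vanishes_in_prob (\<lambda>k \<omega>. T k \<omega> - S k \<omega>)"
    by (simp add: E_def S_def h_def sum_subtractf diff_divide_distrib algebra_simps)

  define v where "v = asym_var F f s"
  have v_eq: "v = 1 / (real s + 1)\<^sup>2 * (real s / a\<^sup>2 - 2 / (a * b) + real s / b\<^sup>2)"
    by (simp add: v_def asym_var_def a_def b_def)
  \<comment> \<open>This decomposition shows that the variance is positive: as
    \<open>s \<ge> 2\<close>, the second term is positive even when \<open>a = b\<close>.\<close>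
  have "real s / a\<^sup>2 - 2 / (a * b) + real s / b\<^sup>2 = (1 / a - 1 / b)\<^sup>2 + (real s - 1) * ((1 / a)\<^sup>2 + (1 / b)\<^sup>2)"
    using a b by (simp add: power2_eq_square field_simps)
  also have "\<dots> > 0"
    using s a b by (intro add_nonneg_pos mult_pos_pos add_pos_pos) auto
  finally have v_pos: "0 < asym_var F f s"
    unfolding v_def[symmetric] v_eq by (intro mult_pos_pos) auto
  have "(LINT x|\<mu>. (h x)\<^sup>2) = (LINT x|\<mu>.
      (centered_indicator q2 x * centered_indicator q2 x) / b\<^sup>2
      - 2 / (a * b) * (centered_indicator q1 x * centered_indicator q2 x)
      + (centered_indicator q1 x * centered_indicator q1 x) / a\<^sup>2)"
    using a b by (intro Bochner_Integration.integral_cong) (auto simp: h_def power2_eq_square field_simps)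
  \<comment> \<open>Since \<open>1 - p_high s = p_low s\<close>, both variances become
    \<open>s / (s + 1)\<^sup>2\<close> and the covariance
    \<open>1 / (s + 1)\<^sup>2\<close>.\<close>
  also have "\<dots> = F q2 * (1 - F q2) / b\<^sup>2 - 2 / (a * b) * (F q1 * (1 - F q2)) + F q1 * (1 - F q1) / a\<^sup>2"
    using \<open>q1 \<le> q2\<close> by (simp add: integral_centered_indicator_mult F_def)
  also have "\<dots> = v"
  proof -
    have compl: "1 - p_high s = p_low s" "1 - p_low s = p_high s"
      by (simp_all add: p_low_def p_high_def field_simps)
    have prods: "p_low s * p_low s = 1 / (real s + 1)\<^sup>2"
      "p_low s * p_high s = 1 / (real s + 1)\<^sup>2 * real s" "p_high s * p_low s = 1 / (real s + 1)\<^sup>2 * real s"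
      by (simp_all add: p_low_def p_high_def power2_eq_square)
    have "c * r / y - z * c + c * r / x = c * (r / x - z + r / y)" for c r x y z :: real
      by (simp add: algebra_simps)
    then show ?thesis unfolding F v_eq by (simp only: compl prods)
  qed
  finally have v_h: "(LINT x|\<mu>. (h x)\<^sup>2) = v" .
  have "(\<lambda>m. cdf (distr M borel (\<lambda>\<omega>. (\<Sum>j<m. h (Y j \<omega>)) / sqrt m)) x) \<longlonglongrightarrow> cdf (normal_distr 0 v) x" for x
  proof (rule central_limit_bounded[OF h _ _ v_h])
    show "\<bar>h x\<bar> \<le> 1 / \<bar>b\<bar> + 1 / \<bar>a\<bar>" for x
    proof -
      have "\<bar>h x\<bar> \<le> \<bar>centered_indicator q2 x / b\<bar> + \<bar>centered_indicator q1 x / a\<bar>"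
        unfolding h_def by (rule abs_triangle_ineq4)
      also have "\<dots> \<le> 1 / \<bar>b\<bar> + 1 / \<bar>a\<bar>"
        unfolding abs_divide by (intro add_mono divide_right_mono abs_centered_indicator_le) auto
      finally show ?thesis .
    qed
    show "(LINT x|\<mu>. h x) = 0" by (simp add: h_def)
    show "0 < v" using v_pos by (simp add: v_def)
  qed
  \<comment> \<open>The limit over all sample sizes \<open>m\<close> is restricted to the sizes
    \<open>n k\<close>, which tend to infinity.\<close>
  from filterlim_compose[OF this n_at_top]
  have "(\<lambda>k. cdf (distr M borel (S k)) x) \<longlonglongrightarrow> cdf (normal_distr 0 v) x" for x
    by (simp add: S_def[abs_def])
  from cdf_tendsto_of_vanishing_difference[OF S T TS this isCont_cdf_normal_distr]
  show "(\<lambda>k. cdf (distr M borel (\<lambda>\<omega>. T_stat F s k (\<lambda>i. Y i \<omega>))) x) \<longlonglongrightarrow> cdf (normal_distr 0 (asym_var F f s)) x"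
    using v_pos by (simp add: v_def T_def[abs_def])
qed

end

section \<open>Samples on varying probability spaces\<close>

lemma (in iid_sequence) iid_sample_prefix: "iid_sample M \<mu> n Y"
  unfolding iid_sample_def by (auto simp: prob_space_axioms distr_Y intro: indep_vars_subset[OF indep])

lemma iid_sequence_PiM:
  assumes "real_distribution \<mu>"
  shows "iid_sequence (PiM UNIV (\<lambda>_::nat. \<mu>)) (\<lambda>i \<omega>. \<omega> i) \<mu>"
proof -
  interpret \<mu>: real_distribution \<mu> by fact
  interpret P: product_prob_space "\<lambda>_::nat. \<mu>" UNIV by standard
  have sets_P: "sets (PiM UNIV (\<lambda>_::nat. \<mu>)) = sets (PiM UNIV (\<lambda>_. borel))"
    by (intro sets_PiM_cong) auto
  have distr: "distr (PiM UNIV (\<lambda>_::nat. \<mu>)) borel (\<lambda>\<omega>. \<omega> i) = \<mu>" for i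
    using P.PiM_component[of i] by (simp add: cong: distr_cong)
  have "prob_space.indep_vars (PiM UNIV (\<lambda>_::nat. \<mu>)) (\<lambda>_. borel) (\<lambda>i \<omega>. \<omega> i) UNIV"
  proof (subst P.P.indep_vars_iff_distr_eq_PiM)
    show "(\<lambda>\<omega>. \<omega> i) \<in> borel_measurable (PiM UNIV (\<lambda>_::nat. \<mu>))" for i
      using measurable_component_singleton[of i UNIV "\<lambda>_. \<mu>"] by simp
    show "distr (PiM UNIV (\<lambda>_::nat. \<mu>)) (PiM UNIV (\<lambda>_. borel)) (\<lambda>x. \<lambda>i\<in>UNIV. x i) =
        PiM UNIV (\<lambda>i. distr (PiM UNIV (\<lambda>_::nat. \<mu>)) borel (\<lambda>\<omega>. \<omega> i))"
      unfolding distr by (simp add: distr_id2 sets_P restrict_UNIV)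
  qed simp
  then show ?thesis
    by (auto simp: iid_sequence_def iid_sequence_axioms_def distr P.P.prob_space_axioms)
qed

text \<open>Independence makes the joint law of the observations a product measure, so the law of
  the statistic depends on \<mu> and \<open>n\<close> alone and not on the underlying space. The
  product characterization of independence is used for a nonempty index set, hence
  \<open>0 < n\<close>.\<close>

lemma distr_iid_sample:
  assumes sample: "iid_sample N \<mu> n Y" and "0 < n"
    and T: "T \<in> borel_measurable (PiM {..<n} (\<lambda>_. borel))"
    and T_cong: "\<And>x. T (restrict x {..<n}) = T x"
  shows "distr N borel (\<lambda>\<omega>. T (\<lambda>i. Y i \<omega>)) = distr (PiM {..<n} (\<lambda>_. \<mu>)) borel T"
proof -
  interpret N: prob_space N using sample by (simp add: iid_sample_def)
  have Y: "Y i \<in> borel_measurable N" if "i < n" for i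
    using sample that by (simp add: iid_sample_def N.indep_vars_def)
  then have restr: "(\<lambda>\<omega>. \<lambda>i\<in>{..<n}. Y i \<omega>) \<in> measurable N (PiM {..<n} (\<lambda>_. borel))"
    by (intro measurable_restrict) auto
  have "distr N borel (\<lambda>\<omega>. T (\<lambda>i. Y i \<omega>)) = distr N borel (T \<circ> (\<lambda>\<omega>. \<lambda>i\<in>{..<n}. Y i \<omega>))"
    by (simp add: comp_def T_cong)
  also have "\<dots> = distr (distr N (PiM {..<n} (\<lambda>_. borel)) (\<lambda>\<omega>. \<lambda>i\<in>{..<n}. Y i \<omega>)) borel T"
    by (rule distr_distr[OF T restr, symmetric])
  also have "distr N (PiM {..<n} (\<lambda>_. borel)) (\<lambda>\<omega>. \<lambda>i\<in>{..<n}. Y i \<omega>) = PiM {..<n} (\<lambda>i. distr N borel (Y i))"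
    using sample \<open>0 < n\<close> Y by (subst N.indep_vars_iff_distr_eq_PiM'[symmetric]) (auto simp: iid_sample_def)
  also have "\<dots> = PiM {..<n} (\<lambda>_. \<mu>)"
    using sample by (intro PiM_cong) (auto simp: iid_sample_def)
  finally show ?thesis .
qed

text \<open>A density is determined only almost everywhere, so \<open>f_low\<close> and
  \<open>f_high\<close> tie \<open>f\<close> to the derivative of \<open>F\<close> at the two
  quantiles. The condition \<open>ratio_pos\<close> gives the centering logarithm its meaning and
  excludes zero quantiles; both may be negative, and the logarithmic derivatives are then those of
  \<open>ln \<bar>x\<bar>\<close>.\<close>

theorem theorem1:
  fixes s :: nat
    and M :: "'a measure" and X :: "'a \<Rightarrow> real"
    and F f :: "real \<Rightarrow> real"
    and N :: "nat \<Rightarrow> 'b measure" and Y :: "nat \<Rightarrow> nat \<Rightarrow> 'b \<Rightarrow> real"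
  assumes s: "2 \<le> s"
    and M: "prob_space M"
    and F: "F = cdf (distr M borel X)"
    and f_nonneg: "\<And>x. 0 \<le> f x"
    and f_density: "distributed M lborel X (\<lambda>x. ennreal (f x))"
    and f_low: "(F has_real_derivative f (quantile F (p_low s))) (at (quantile F (p_low s)))"
    and f_high: "(F has_real_derivative f (quantile F (p_high s))) (at (quantile F (p_high s)))"
    and f_low_pos: "0 < f (quantile F (p_low s))"
    and f_high_pos: "0 < f (quantile F (p_high s))"
    and ratio_pos: "0 < quantile F (p_high s) / quantile F (p_low s)"
    and sample: "\<And>k. 1 \<le> k \<Longrightarrow> iid_sample (N k) (distr M borel X) ((s + 1) * k - 1) (Y k)"
  shows "weak_conv_m (\<lambda>k. distr (N k) borel (\<lambda>\<omega>. T_stat F s k (\<lambda>i. Y k i \<omega>)))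
           (normal_distr 0 (asym_var F f s))
       \<and> (\<exists>D. ((\<lambda>p. ln (quantile F p)) has_real_derivative D) (at (p_low s)) \<and> a_coeff F f s = 1 / D)
       \<and> (\<exists>D. ((\<lambda>p. ln (quantile F p)) has_real_derivative D) (at (p_high s)) \<and> b_coeff F f s = 1 / D)"
proof -
  interpret M: prob_space M by (rule M)
  define \<mu> where "\<mu> = distr M borel X"
  have X [measurable]: "X \<in> borel_measurable M"
    using distributed_measurable[OF f_density] by simp
  interpret \<mu>: real_distribution \<mu> unfolding \<mu>_def by simp
  have F: "F = cdf \<mu>" by (simp add: F \<mu>_def)
  \<comment> \<open>A law with a density has no atoms.\<close>
  have cont: "isCont F x" for x
  proof -
    have "\<mu> = density lborel (\<lambda>x. ennreal (f x))"
      using distributed_distr_eq_density[OF f_density] by (simp add: \<mu>_def cong: distr_cong)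
    then have "emeasure \<mu> {x} = 0"
      using distributed_borel_measurable[OF f_density] by (simp add: emeasure_density nn_integral_indicator_singleton)
    then show ?thesis by (simp add: F \<mu>.isCont_cdf measure_def)
  qed
  have q: "quantile F (p_low s) \<noteq> 0" "quantile F (p_high s) \<noteq> 0"
    using ratio_pos by auto
  have p: "0 < p_low s" "p_low s < 1" "0 < p_high s" "p_high s < 1"
    using s by (simp_all add: p_low_def p_high_def)
  \<comment> \<open>By the chain rule the derivative is \<open>1 / (q * d)\<close> with
    \<open>q\<close> the quantile, the reciprocal of the coefficient.\<close>
  have ln_quantile: "\<exists>D. ((\<lambda>p. ln (quantile F p)) has_real_derivative D) (at p) \<and> quantile F p * d = 1 / D"
    if "0 < p" "p < 1" "(F has_real_derivative d) (at (quantile F p))" "0 < d" "quantile F p \<noteq> 0" for p d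
    using DERIV_chain2[OF has_real_derivative_ln_nonzero \<mu>.quantile_has_real_derivative, of p d] that cont
    by (intro exI[of _ "inverse (quantile F p) * inverse d"]) (simp add: F divide_inverse)

  define P where "P = PiM UNIV (\<lambda>_::nat. \<mu>)"
  interpret P: iid_sequence P "\<lambda>i \<omega>. \<omega> i" \<mu>
    unfolding P_def by (rule iid_sequence_PiM) (rule \<mu>.real_distribution_axioms)
  define T where "T k \<omega> = T_stat F s k (\<lambda>i. \<omega> i)" for k and \<omega> :: "nat \<Rightarrow> real"
  have T_PiM: "T k \<in> borel_measurable (PiM {..<(s + 1) * k - 1} (\<lambda>_. borel))" for k
    unfolding T_def[abs_def] using s by (intro T_stat_measurable) auto
  have T_restrict: "T k (restrict x {..<(s + 1) * k - 1}) = T k x" for k x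
    unfolding T_def by (rule T_stat_cong) auto
  \<comment> \<open>Both laws are the image of the same finite product measure under
    \<open>T k\<close>. The case \<open>k = 0\<close>, where no sample is given, is immaterial for
    the limit.\<close>
  have distr_eq: "distr (N k) borel (\<lambda>\<omega>. T_stat F s k (\<lambda>i. Y k i \<omega>)) = distr P borel (T k)" if k: "1 \<le> k" for k
  proof -
    have "2 * 1 \<le> (s + 1) * k" using k s by (intro mult_le_mono) auto
    then have n: "0 < (s + 1) * k - 1" by linarith
    show ?thesis
      using distr_iid_sample[OF sample[OF k, folded \<mu>_def] n T_PiM T_restrict]
        distr_iid_sample[OF P.iid_sample_prefix n T_PiM T_restrict]
      by (simp add: T_def[abs_def])
  qed
  have lim: "(\<lambda>k. cdf (distr P borel (T k)) x) \<longlonglongrightarrow> cdf (normal_distr 0 (asym_var F f s)) x" for x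
    unfolding T_def[abs_def] F
    by (rule P.T_stat_asymptotically_normal)
      (use s cont q f_low f_high f_low_pos f_high_pos in \<open>simp_all add: F\<close>)
  have "(\<lambda>k. cdf (distr (N k) borel (\<lambda>\<omega>. T_stat F s k (\<lambda>i. Y k i \<omega>))) x)
      \<longlonglongrightarrow> cdf (normal_distr 0 (asym_var F f s)) x" for x
    by (rule Lim_transform_eventually[OF lim]) (auto simp: distr_eq intro: eventually_sequentiallyI[of 1])
  then show ?thesis
    using ln_quantile[OF p(1,2) f_low f_low_pos q(1)] ln_quantile[OF p(3,4) f_high f_high_pos q(2)]
    by (simp add: weak_conv_m_def weak_conv_def a_coeff_def b_coeff_def)
qed

end
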